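(* Let $f(\varphi_1,u)=a(\varphi_1)u^D$ with $D\geq 2$ an even integer, $a\in H^s(\mathbb{T})$ (Sobolev space), $s\ge1$, and $\int_0^{2\pi}a(\varphi_1)\,d\varphi_1\neq0$. Let $0<\gamma<1/6$. For every $R>0$ there exists $\varepsilon_1>0$ such that for all $\sigma\ge0$, all $\overline s>s-\frac12$ and all $(\varepsilon,\omega_1)\in\mathcal{C}_\gamma$ with $|\varepsilon|<\varepsilon_1$, the equation $$\Big[\omega_1^2\partial^2_{\varphi_1}+(\omega_2^2-1)\partial^2_{\varphi_2}+2\omega_1\omega_2\partial_{\varphi_1}\partial_{\varphi_2}\Big]u(\varphi)+f(\varphi_1,u)=0,\qquad\omega_2=1+\varepsilon,$$ does not possess non-trivial solutions $u\in\mathcal{H}_{\sigma,\overline s}$ in the ball $|u|_{\sigma,\overline s}\le R|\varepsilon|^{1/(D-1)}$.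
   Context: $\mathbb{T}=\mathbb{R}/2\pi\mathbb{Z}$, $\varphi=(\varphi_1,\varphi_2)\in\mathbb{T}^2$. Fix a small $\varepsilon_0>0$. With $\omega_2=1+\varepsilon$, $\mathcal{C}_\gamma$ is the set of $(\varepsilon,\omega_1)\in(-\varepsilon_0,\varepsilon_0)\times(1,2)$ such that $\omega_1\notin\mathbb{Q}$, $\omega_1/\omega_2\notin\mathbb{Q}$ and, for all $l_1,l_2\in\mathbb{Z}\setminus\{0\}$, $$|\omega_1l_1+\varepsilon l_2|>\frac{\gamma}{|l_1|+|l_2|},\qquad|\omega_1l_1+(2+\varepsilon)l_2|>\frac{\gamma}{|l_1|+|l_2|}.$$ For $\sigma,s'\ge0$, with $[l_1]:=\max\{|l_1|,1\}$, $$\mathcal{H}_{\sigma,s'}:=\Big\{u(\varphi)=\sum_{l\in\mathbb{Z}^2}\hat u_l e^{\mathrm{i}l\cdot\varphi}\ :\ \hat u_l^*=\hat u_{-l},\ |u|_{\sigma,s'}:=\sum_{l\in\mathbb{Z}^2}|\hat u_l|e^{|l_2|\sigma}[l_1]^{s'}<+\infty\Big\}.$$ Solutions are understood in the weak (distributional, i.e. Fourier-coefficientwise) sense. *)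

theory Defs
  imports "HOL-Analysis.Analysis"
begin

text \<open>
  Functions on the torus are functions on the line (resp. the plane), and the integrals below run
  over one period.
\<close>

definition fourier_coeff :: "(real \<Rightarrow> complex) \<Rightarrow> int \<Rightarrow> complex" where
  "fourier_coeff g k =
     (LINT x:{0..2 * pi}|lebesgue. g x * cis (- (of_int k * x))) / of_real (2 * pi)"

definition fourier_coeff2 :: "(real \<times> real \<Rightarrow> complex) \<Rightarrow> int \<times> int \<Rightarrow> complex" where
  "fourier_coeff2 g l =
     (LINT \<phi>:{0..2 * pi} \<times> {0..2 * pi}|lebesgue.
        g \<phi> * cis (- (of_int (fst l) * fst \<phi> + of_int (snd l) * snd \<phi>))) / of_real ((2 * pi)\<^sup>2)"

text \<open>
  Representatives of the elements of the real Sobolev space of order \<open>s\<close> on the torus, for real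
  \<open>s \<ge> 0\<close>.  All notions in which they are used below are invariant under changes on null sets.
\<close>

definition sobolev_torus :: "real \<Rightarrow> (real \<Rightarrow> real) set" where
  "sobolev_torus s =
     {a. a \<in> borel_measurable lebesgue \<and>
         (\<forall>x. a (x + 2 * pi) = a x) \<and>
         set_integrable lebesgue {0..2 * pi} (\<lambda>x. (a x)\<^sup>2) \<and>
         (\<lambda>k::int. (1 + (of_int k)\<^sup>2) powr s * (cmod (fourier_coeff (\<lambda>x. of_real (a x)) k))\<^sup>2)
           summable_on UNIV}"

abbreviation coeff :: "(real \<times> real \<Rightarrow> real) \<Rightarrow> int \<times> int \<Rightarrow> complex" where
  "coeff u \<equiv> fourier_coeff2 (\<lambda>\<phi>. of_real (u \<phi>))"

definition weight :: "real \<Rightarrow> real \<Rightarrow> int \<times> int \<Rightarrow> real" where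
  "weight \<sigma> s l =
     exp (of_int \<bar>snd l\<bar> * \<sigma>) * (max (of_int \<bar>fst l\<bar>) 1) powr s"

definition H_norm :: "real \<Rightarrow> real \<Rightarrow> (real \<times> real \<Rightarrow> real) \<Rightarrow> real" where
  "H_norm \<sigma> s u = (\<Sum>\<^sub>\<infinity>l. cmod (coeff u l) * weight \<sigma> s l)"

text \<open>
  The symmetry of the coefficients expresses that \<open>u\<close> is real-valued, so it is automatic here.
  Periodicity of \<open>u\<close> follows from the representation by its Fourier series.
\<close>

definition H_space :: "real \<Rightarrow> real \<Rightarrow> (real \<times> real \<Rightarrow> real) set" where
  "H_space \<sigma> s =
     {u. (\<forall>l. cnj (coeff u l) = coeff u (- l)) \<and>
         (\<lambda>l. cmod (coeff u l) * weight \<sigma> s l) summable_on UNIV \<and>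
         (\<forall>\<phi>. ((\<lambda>l. coeff u l * cis (of_int (fst l) * fst \<phi> + of_int (snd l) * snd \<phi>))
                 has_sum of_real (u \<phi>)) UNIV)}"

definition diophantine_set :: "real \<Rightarrow> real \<Rightarrow> (real \<times> real) set" where
  "diophantine_set \<epsilon>0 \<gamma> =
     {(\<epsilon>, \<omega>1). \<epsilon> \<in> {- \<epsilon>0<..<\<epsilon>0} \<and> \<omega>1 \<in> {1<..<2} \<and>
        \<omega>1 \<notin> \<rat> \<and> \<omega>1 / (1 + \<epsilon>) \<notin> \<rat> \<and>
        (\<forall>l1 l2 :: int. l1 \<noteq> 0 \<longrightarrow> l2 \<noteq> 0 \<longrightarrow>
           \<bar>\<omega>1 * of_int l1 + \<epsilon> * of_int l2\<bar> > \<gamma> / of_int (\<bar>l1\<bar> + \<bar>l2\<bar>) \<and>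
           \<bar>\<omega>1 * of_int l1 + (2 + \<epsilon>) * of_int l2\<bar> > \<gamma> / of_int (\<bar>l1\<bar> + \<bar>l2\<bar>))}"

text \<open>
  The multiplier by which the differential operator
  \<open>\<omega>1\<^sup>2 \<partial>1\<^sup>2 + (\<omega>2\<^sup>2 - 1) \<partial>2\<^sup>2 + 2 \<omega>1 \<omega>2 \<partial>1 \<partial>2\<close>
  acts on the Fourier coefficient at \<open>l\<close>: \<open>\<partial>1\<close> and \<open>\<partial>2\<close> become multiplication by
  \<open>\<i> * fst l\<close> and \<open>\<i> * snd l\<close>.
\<close>

definition wave_symbol :: "real \<Rightarrow> real \<Rightarrow> int \<times> int \<Rightarrow> complex" where
  "wave_symbol \<omega>1 \<omega>2 l =
     of_real (\<omega>1\<^sup>2) * (\<i> * of_int (fst l))\<^sup>2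
     + of_real (\<omega>2\<^sup>2 - 1) * (\<i> * of_int (snd l))\<^sup>2
     + of_real (2 * \<omega>1 * \<omega>2) * (\<i> * of_int (fst l)) * (\<i> * of_int (snd l))"

text \<open>
  The equation in the sense of distributions on the torus, tested against the exponentials.
\<close>

definition weak_solution ::
    "(real \<Rightarrow> real \<Rightarrow> real) \<Rightarrow> real \<Rightarrow> real \<Rightarrow> (real \<times> real \<Rightarrow> real) \<Rightarrow> bool" where
  "weak_solution f \<omega>1 \<omega>2 u \<longleftrightarrow>
     (\<forall>l. wave_symbol \<omega>1 \<omega>2 l * coeff u l + coeff (\<lambda>\<phi>. f (fst \<phi>) (u \<phi>)) l = 0)"

end

theory Submission
  imports Defs
begin

text \<open>
  Let \<open>U\<close> be the \<open>\<ell>\<^sup>1\<close> norm of the Fourier coefficients of a solution \<open>u\<close>; the ball condition gives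
  \<open>U ^ (D - 1) \<le> R ^ (D - 1) * \<bar>\<epsilon>\<bar>\<close>.  As \<open>s \<ge> 1\<close>, the coefficients of \<open>a\<close> are summable, so those of \<open>a u\<^sup>D\<close>
  have norm at most \<open>C U\<^sup>D \<le> C' \<bar>\<epsilon>\<bar> U\<close>.  Off \<open>l1 = 0\<close> the symbol is at least \<open>\<gamma> / 3\<close>, hence that part of \<open>u\<close> is
  \<open>O(\<bar>\<epsilon>\<bar> U)\<close>.  On \<open>l1 = 0\<close> the symbol is at least \<open>\<bar>\<epsilon>\<bar> l2\<^sup>2\<close>, hence the coefficients of the remaining part
  \<open>q(\<phi>2)\<close> have norm \<open>O(U / n\<^sup>2)\<close> on \<open>\<bar>l2\<bar> > n\<close>, and some coefficient with \<open>\<bar>l2\<bar> \<le> n\<close> is at least \<open>c U\<close> for a fixed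
  \<open>n\<close>.  By Jensen's inequality and evenness of \<open>D\<close> the mean of \<open>q\<^sup>D\<close> is at least \<open>(c' U)\<^sup>D\<close>.  But the equation at
  \<open>l = 0\<close> says that \<open>a u\<^sup>D\<close> has mean zero, so the mean of \<open>a\<close> times that of \<open>q\<^sup>D\<close> is \<open>O(\<bar>\<epsilon>\<bar> U\<^sup>D)\<close>, which forces
  \<open>U = 0\<close> when \<open>\<epsilon>\<close> is small.
\<close>

section \<open>Integration over one period and Borel representatives\<close>

text \<open>An integral over the completion depends only on the class modulo null sets and agrees
  with that over \<open>lborel\<close> for Borel integrands. This moves the coefficients, which are
  defined with \<open>lebesgue\<close>, to a setting with Fubini and composition of Borel
  maps.\<close>

lemma set_integral_lebesgue_restrict_AE:
  fixes f g :: "'a::euclidean_space \<Rightarrow> 'b::euclidean_space"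
  assumes S: "S \<in> sets borel" and g: "g \<in> borel_measurable borel"
    and ae: "AE x in lborel. f x = g x"
  shows "(LINT x:S|lebesgue. f x) = integral\<^sup>L (restrict_space lborel S) g"
proof -
  have ae': "AE x in lebesgue. g x = f x"
    using AE_completion[OF ae] by (auto elim: eventually_mono)
  have gm: "g \<in> borel_measurable lebesgue"
    using g by (intro measurable_completion) simp
  have fm: "f \<in> borel_measurable lebesgue"
    by (rule borel_measurable_AE[OF gm ae'])
  have "(LINT x:S|lebesgue. f x) = (LINT x:S|lebesgue. g x)"
    using S by (intro set_lebesgue_integral_cong_AE fm gm eventually_mono[OF ae']) simp_all
  also have "\<dots> = (\<integral>x. indicator S x *\<^sub>R g x \<partial>lborel)"
    unfolding set_lebesgue_integral_def using S g by (intro integral_completion) auto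
  also have "\<dots> = integral\<^sup>L (restrict_space lborel S) g"
    using S by (subst integral_restrict_space) auto
  finally show ?thesis .
qed

definition circle :: "real measure" where
  "circle = restrict_space lborel {0..2 * pi}"

definition torus :: "(real \<times> real) measure" where
  "torus = restrict_space lborel ({0..2 * pi} \<times> {0..2 * pi})"

lemma period_square_borel [simp, measurable]:
  "{0..2 * pi} \<times> {0..2 * pi} \<in> sets (borel :: (real \<times> real) measure)"
  by (simp add: borel_closed closed_Times)

lemma measurable_circle:
  "f \<in> borel_measurable borel \<Longrightarrow> f \<in> borel_measurable circle"
  by (simp add: circle_def measurable_restrict_space1)

lemma measurable_torus:
  "f \<in> borel_measurable borel \<Longrightarrow> f \<in> borel_measurable torus"
  by (simp add: torus_def measurable_restrict_space1)

lemma measurable_fst_borel [measurable]: "(fst :: real \<times> real \<Rightarrow> real) \<in> borel_measurable borel"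
  by (simp add: borel_measurable_continuous_onI continuous_on_fst)

lemma measurable_snd_borel [measurable]: "(snd :: real \<times> real \<Rightarrow> real) \<in> borel_measurable borel"
  by (simp add: borel_measurable_continuous_onI continuous_on_snd)

lemma measurable_cis [measurable]: "cis \<in> borel_measurable borel"
  by (intro borel_measurable_continuous_onI continuous_on_cis continuous_on_id)

lemma measure_circle: "measure circle (space circle) = 2 * pi"
  by (simp add: circle_def measure_restrict_space space_restrict_space)

lemma measure_torus: "measure torus (space torus) = (2 * pi)\<^sup>2"
proof -
  have "emeasure lborel ({0..2 * pi} \<times> {0..2 * pi}) = ennreal ((2 * pi)\<^sup>2)"
    unfolding lborel_prod[symmetric]
    by (subst lborel.emeasure_pair_measure_Times)
       (auto simp: power2_eq_square ennreal_mult[symmetric])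
  then have "measure lborel ({0..2 * pi} \<times> {0..2 * pi}) = (2 * pi)\<^sup>2"
    by (simp add: measure_def)
  then show ?thesis
    by (simp add: torus_def measure_restrict_space space_restrict_space)
qed

lemma finite_measure_circle: "finite_measure circle"
  by (rule finite_measureI) (simp add: circle_def emeasure_restrict_space space_restrict_space)

lemma finite_measure_torus: "finite_measure torus"
proof (rule finite_measureI)
  have "emeasure lborel ({0..2 * pi} \<times> {0..2 * pi}) < \<infinity>"
    unfolding lborel_prod[symmetric]
    by (subst lborel.emeasure_pair_measure_Times) (auto simp: ennreal_mult[symmetric])
  then show "emeasure torus (space torus) \<noteq> \<infinity>"
    by (simp add: torus_def emeasure_restrict_space space_restrict_space)
qed

text \<open>Fubini for the two factors extended by zero outside the period, since
  \<open>lborel\<close> on the plane is the product measure.\<close>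

lemma
  fixes g h :: "real \<Rightarrow> 'b::{real_normed_field, euclidean_space}"
  assumes g: "integrable circle g" and h: "integrable circle h"
  shows integrable_torus_product: "integrable torus (\<lambda>\<phi>. g (fst \<phi>) * h (snd \<phi>))"
    and integral_torus_product:
      "(\<integral>\<phi>. g (fst \<phi>) * h (snd \<phi>) \<partial>torus) = integral\<^sup>L circle g * integral\<^sup>L circle h"
proof -
  define G where "G = (\<lambda>x. indicator {0..2 * pi} x *\<^sub>R g x)"
  define H where "H = (\<lambda>x. indicator {0..2 * pi} x *\<^sub>R h x)"
  have G: "integrable lborel G" and H: "integrable lborel H"
    using g h by (simp_all add: circle_def integrable_restrict_space G_def H_def)
  have [measurable]: "G \<in> borel_measurable lborel" "H \<in> borel_measurable lborel"
    using G H by auto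
  have int: "integrable (lborel \<Otimes>\<^sub>M lborel) (\<lambda>\<phi>. G (fst \<phi>) * H (snd \<phi>))"
    using G H by (intro lborel_pair.Fubini_integrable) (auto simp: norm_mult)
  have eq: "(\<lambda>\<phi>. indicator ({0..2 * pi} \<times> {0..2 * pi}) \<phi> *\<^sub>R (g (fst \<phi>) * h (snd \<phi>)))
      = (\<lambda>\<phi>. G (fst \<phi>) * H (snd \<phi>))"
    by (auto simp: G_def H_def indicator_times fun_eq_iff)
  show "integrable torus (\<lambda>\<phi>. g (fst \<phi>) * h (snd \<phi>))"
    using int by (simp add: torus_def integrable_restrict_space eq lborel_prod)
  have "(\<integral>\<phi>. g (fst \<phi>) * h (snd \<phi>) \<partial>torus) = (\<integral>\<phi>. G (fst \<phi>) * H (snd \<phi>) \<partial>(lborel \<Otimes>\<^sub>M lborel))"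
    by (simp add: torus_def integral_restrict_space eq lborel_prod)
  also have "\<dots> = (\<integral>x. (\<integral>y. G x * H y \<partial>lborel) \<partial>lborel)"
    using lborel_pair.integral_fst'[OF int] by simp
  also have "\<dots> = integral\<^sup>L lborel G * integral\<^sup>L lborel H"
    using G H by simp
  finally show "(\<integral>\<phi>. g (fst \<phi>) * h (snd \<phi>) \<partial>torus) = integral\<^sup>L circle g * integral\<^sup>L circle h"
    by (simp add: circle_def integral_restrict_space G_def H_def)
qed

lemma fourier_coeff_AE:
  assumes "g \<in> borel_measurable borel" and "AE x in lborel. f x = g x"
  shows "fourier_coeff f k = (\<integral>x. g x * cis (- (of_int k * x)) \<partial>circle) / of_real (2 * pi)"
  unfolding fourier_coeff_def circle_def using assms
  by (subst set_integral_lebesgue_restrict_AE[where g = "\<lambda>x. g x * cis (- (of_int k * x))"])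
     (auto elim!: eventually_mono)

lemma fourier_coeff2_AE:
  assumes "g \<in> borel_measurable borel" and "AE \<phi> in lborel. f \<phi> = g \<phi>"
  shows "fourier_coeff2 f l =
    (\<integral>\<phi>. g \<phi> * cis (- (of_int (fst l) * fst \<phi> + of_int (snd l) * snd \<phi>)) \<partial>torus)
      / of_real ((2 * pi)\<^sup>2)"
  unfolding fourier_coeff2_def torus_def using assms
  by (subst set_integral_lebesgue_restrict_AE
        [where g = "\<lambda>\<phi>. g \<phi> * cis (- (of_int (fst l) * fst \<phi> + of_int (snd l) * snd \<phi>))"])
     (auto elim!: eventually_mono)

text \<open>A null set times the line is null. Hence replacing \<open>a\<close> by a Borel function
  changes functions of both angles only on a null set.\<close>

lemma AE_lborel_fst:
  assumes "AE x in (lborel :: real measure). P x"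
  shows "AE \<phi> in (lborel :: (real \<times> real) measure). P (fst \<phi>)"
proof -
  obtain N where N: "N \<in> sets lborel" "emeasure lborel N = 0" "{x. \<not> P x} \<subseteq> N"
    using assms by (auto elim!: AE_E)
  have "emeasure lborel (N \<times> (UNIV :: real set)) = 0"
    unfolding lborel_prod[symmetric] using N
    by (subst lborel.emeasure_pair_measure_Times) auto
  moreover have "N \<times> (UNIV :: real set) \<in> sets lborel"
    using N(1) unfolding lborel_prod[symmetric] by (intro pair_measureI) auto
  ultimately show ?thesis
    using N(3) by (intro AE_I[where N = "N \<times> UNIV"]) auto
qed

section \<open>Products with absolutely convergent Fourier series\<close>

abbreviation character :: "int \<times> int \<Rightarrow> real \<times> real \<Rightarrow> complex" where
  "character l \<phi> \<equiv> cis (of_int (fst l) * fst \<phi> + of_int (snd l) * snd \<phi>)"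

lemma character_minus: "character (- l) \<phi> = cis (- (of_int (fst l) * fst \<phi> + of_int (snd l) * snd \<phi>))"
  by (simp add: algebra_simps)

lemma fourier_coeff2_borel:
  assumes "g \<in> borel_measurable borel"
  shows "fourier_coeff2 g l = (\<integral>\<phi>. g \<phi> * character (- l) \<phi> \<partial>torus) / of_real ((2 * pi)\<^sup>2)"
  using fourier_coeff2_AE[OF assms, of g l] unfolding character_minus by simp

lemma norm_has_sum_le:
  fixes f :: "'a \<Rightarrow> 'b::banach"
  assumes "f abs_summable_on A" and "(f has_sum s) A"
  shows "norm s \<le> (\<Sum>\<^sub>\<infinity>x\<in>A. norm (f x))"
  using norm_infsum_bound[OF assms(1)] assms(2) by (simp add: infsumI)

text \<open>Along an enumeration of the pairs of integers the series is an ordinary one, dominated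
  by the sum of \<open>cmod (c l)\<close>. So measurability passes to the limit, and the product
  with an integrable \<open>g\<close> may be integrated termwise, which turns multiplication into
  convolution of coefficients.\<close>

lemma
  fixes c :: "int \<times> int \<Rightarrow> complex" and g w :: "real \<times> real \<Rightarrow> complex"
  assumes c: "(\<lambda>l. cmod (c l)) summable_on UNIV"
    and w: "\<And>\<phi>. ((\<lambda>l. c l * character l \<phi>) has_sum w \<phi>) UNIV"
  shows fourier_series_measurable: "w \<in> borel_measurable borel"
    and fourier_series_bound: "cmod (w \<phi>) \<le> (\<Sum>\<^sub>\<infinity>l. cmod (c l))"
    and fourier_coeff2_mult_series:
      "g \<in> borel_measurable borel \<Longrightarrow> integrable torus g \<Longrightarrow>
       ((\<lambda>l. c l * fourier_coeff2 g (k - l)) has_sum fourier_coeff2 (\<lambda>\<phi>. g \<phi> * w \<phi>) k) UNIV"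
proof -
  define e :: "nat \<Rightarrow> int \<times> int" where "e = from_nat_into UNIV"
  have e: "bij_betw e UNIV UNIV"
    unfolding e_def by (intro bij_betw_from_nat_into) (auto simp: finite_prod)
  have sc: "summable (\<lambda>n. cmod (c (e n)))"
    using c by (subst (asm) summable_on_reindex_bij_betw[OF e, symmetric])
       (rule summable_on_imp_summable)
  have ws: "(\<lambda>n. c (e n) * character (e n) \<phi>) sums w \<phi>" for \<phi>
    using w[of \<phi>] by (subst (asm) has_sum_reindex_bij_betw[OF e, symmetric]) (rule has_sum_imp_sums)
  have "w = (\<lambda>\<phi>. \<Sum>n. c (e n) * character (e n) \<phi>)"
    using ws by (auto simp: sums_iff)
  then show wm [measurable]: "w \<in> borel_measurable borel"
    by simp
  show "cmod (w \<phi>) \<le> (\<Sum>\<^sub>\<infinity>l. cmod (c l))"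
    using norm_has_sum_le[OF _ w[of \<phi>]] c by (simp add: norm_mult)
  assume g [measurable]: "g \<in> borel_measurable borel" and gi: "integrable torus g"
  define f where "f n \<phi> = g \<phi> * (c (e n) * character (e n) \<phi>) * character (- k) \<phi>" for n \<phi>
  have nf: "norm (f n \<phi>) = cmod (c (e n)) * norm (g \<phi>)" for n \<phi>
    by (simp add: f_def norm_mult)
  have fm: "f n \<in> borel_measurable torus" for n
    unfolding f_def by (intro measurable_torus) measurable
  have fi: "integrable torus (f n)" for n
    by (rule Bochner_Integration.integrable_bound[OF integrable_mult_right[OF integrable_norm[OF gi], of "cmod (c (e n))"] fm])
       (simp add: nf abs_mult)
  have "(\<lambda>n. integral\<^sup>L torus (f n)) sums (\<integral>\<phi>. (\<Sum>n. f n \<phi>) \<partial>torus)"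
  proof (rule sums_integral[OF fi])
    show "AE \<phi> in torus. summable (\<lambda>n. norm (f n \<phi>))"
      using sc by (simp add: nf summable_mult2)
    show "summable (\<lambda>n. \<integral>\<phi>. norm (f n \<phi>) \<partial>torus)"
      using sc by (simp add: nf summable_mult2)
  qed
  moreover have "(\<lambda>n. f n \<phi>) sums (g \<phi> * w \<phi> * character (- k) \<phi>)" for \<phi>
    unfolding f_def by (intro sums_mult sums_mult2 ws)
  then have "(\<Sum>n. f n \<phi>) = g \<phi> * w \<phi> * character (- k) \<phi>" for \<phi>
    by (simp add: sums_iff)
  moreover have "integral\<^sup>L torus (f n) = of_real ((2 * pi)\<^sup>2) * (c (e n) * fourier_coeff2 g (k - e n))" for n
  proof -
    have "f n = (\<lambda>\<phi>. c (e n) * (g \<phi> * character (- (k - e n)) \<phi>))"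
      by (simp add: f_def cis_mult algebra_simps fun_eq_iff)
    then show ?thesis
      by (simp only: fourier_coeff2_borel[OF g] integral_mult_right_zero) simp
  qed
  ultimately have "(\<lambda>n. of_real ((2 * pi)\<^sup>2) * (c (e n) * fourier_coeff2 g (k - e n)))
      sums (of_real ((2 * pi)\<^sup>2) * fourier_coeff2 (\<lambda>\<phi>. g \<phi> * w \<phi>) k)"
    by (simp add: fourier_coeff2_borel)
  then have S: "(\<lambda>n. c (e n) * fourier_coeff2 g (k - e n)) sums fourier_coeff2 (\<lambda>\<phi>. g \<phi> * w \<phi>) k"
    by (subst (asm) sums_mult_iff) auto
  \<comment> \<open>The coefficients of \<open>g\<close> are bounded by the mean of its modulus;
    thus the convolution series converges absolutely and its sum does not depend on the
    enumeration.\<close>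
  define G where "G = (\<integral>\<phi>. norm (g \<phi>) \<partial>torus) / (2 * pi)\<^sup>2"
  have "cmod (fourier_coeff2 g l) \<le> G" for l
    unfolding fourier_coeff2_borel[OF g] G_def norm_divide
    using integral_norm_bound[of torus "\<lambda>\<phi>. g \<phi> * character (- l) \<phi>"]
    by (auto simp: norm_mult norm_power intro!: divide_right_mono)
  then have "summable (\<lambda>n. norm (c (e n) * fourier_coeff2 g (k - e n)))"
    by (intro summable_comparison_test'[OF summable_mult2[OF sc, of G]])
      (simp add: norm_mult mult_left_mono)
  from norm_summable_imp_has_sum[OF this S]
  show "((\<lambda>l. c l * fourier_coeff2 g (k - l)) has_sum fourier_coeff2 (\<lambda>\<phi>. g \<phi> * w \<phi>) k) UNIV"
    by (rule iffD1[OF has_sum_reindex_bij_betw[OF e, where f = "\<lambda>l. c l * fourier_coeff2 g (k - l)"]])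
qed

lemma infsum_shift:
  fixes h :: "'a::ab_group_add \<Rightarrow> real"
  shows "(\<lambda>k. h (k - l)) summable_on UNIV \<longleftrightarrow> h summable_on UNIV"
    and "(\<Sum>\<^sub>\<infinity>k. h (k - l)) = (\<Sum>\<^sub>\<infinity>k. h k)"
proof -
  have bij: "bij_betw (\<lambda>k. k - l) UNIV UNIV"
    by (rule bij_betwI[where g = "\<lambda>k. k + l"]) auto
  show "(\<lambda>k. h (k - l)) summable_on UNIV \<longleftrightarrow> h summable_on UNIV"
    by (rule summable_on_reindex_bij_betw[OF bij])
  show "(\<Sum>\<^sub>\<infinity>k. h (k - l)) = (\<Sum>\<^sub>\<infinity>k. h k)"
    by (rule infsum_reindex_bij_betw[OF bij])
qed

text \<open>The convolution inequality in \<open>\<ell>\<^sup>1\<close>: interchange the sums and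
  use that a shift does not change the norm of the coefficients of \<open>g\<close>.\<close>

lemma
  fixes c :: "int \<times> int \<Rightarrow> complex" and g w :: "real \<times> real \<Rightarrow> complex"
  assumes c: "(\<lambda>l. cmod (c l)) summable_on UNIV"
    and w: "\<And>\<phi>. ((\<lambda>l. c l * character l \<phi>) has_sum w \<phi>) UNIV"
    and g: "g \<in> borel_measurable borel" "integrable torus g"
    and gs: "(\<lambda>l. cmod (fourier_coeff2 g l)) summable_on UNIV"
  shows summable_coeff_mult_series:
      "(\<lambda>l. cmod (fourier_coeff2 (\<lambda>\<phi>. g \<phi> * w \<phi>) l)) summable_on UNIV" (is ?S)
    and infsum_coeff_mult_series:
      "(\<Sum>\<^sub>\<infinity>l. cmod (fourier_coeff2 (\<lambda>\<phi>. g \<phi> * w \<phi>) l))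
        \<le> (\<Sum>\<^sub>\<infinity>l. cmod (fourier_coeff2 g l)) * (\<Sum>\<^sub>\<infinity>l. cmod (c l))" (is "_ \<le> ?B")
proof -
  define N where "N = (\<Sum>\<^sub>\<infinity>l. cmod (fourier_coeff2 g l))"
  let ?t = "\<lambda>k l. cmod (c l) * cmod (fourier_coeff2 g (k - l))"
  have gN: "cmod (fourier_coeff2 g l) \<le> N" for l
    using finite_sum_le_infsum[OF gs, of "{l}"] by (simp add: N_def)
  have ts: "?t k summable_on UNIV" for k
    by (rule summable_on_comparison_test[OF summable_on_cmult_left[OF c, of N]])
       (auto intro!: mult_left_mono gN)
  have bound: "cmod (fourier_coeff2 (\<lambda>\<phi>. g \<phi> * w \<phi>) k) \<le> (\<Sum>\<^sub>\<infinity>l. ?t k l)" for k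
    using norm_has_sum_le[OF _ fourier_coeff2_mult_series[OF c w g, of k]] ts[of k]
    by (simp add: norm_mult)
  \<comment> \<open>Only finitely many \<open>k\<close> are taken at once, so the interchange with
    the sum over \<open>l\<close> is mere additivity. The bound is uniform in \<open>F\<close> and
    therefore yields summability as well.\<close>
  have fin: "(\<Sum>k\<in>F. cmod (fourier_coeff2 (\<lambda>\<phi>. g \<phi> * w \<phi>) k)) \<le> ?B" if F: "finite F" for F
  proof -
    have sum_has: "((\<lambda>l. \<Sum>k\<in>F. ?t k l) has_sum (\<Sum>k\<in>F. \<Sum>\<^sub>\<infinity>l. ?t k l)) UNIV"
      using F by (induction F) (simp_all add: has_sum_add ts)
    then have s: "(\<lambda>l. cmod (c l) * (\<Sum>k\<in>F. cmod (fourier_coeff2 g (k - l)))) summable_on UNIV"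
      by (simp add: has_sum_iff sum_distrib_left)
    have "(\<Sum>k\<in>F. cmod (fourier_coeff2 (\<lambda>\<phi>. g \<phi> * w \<phi>) k)) \<le> (\<Sum>k\<in>F. \<Sum>\<^sub>\<infinity>l. ?t k l)"
      by (intro sum_mono bound)
    also have "(\<Sum>k\<in>F. \<Sum>\<^sub>\<infinity>l. ?t k l) = (\<Sum>\<^sub>\<infinity>l. cmod (c l) * (\<Sum>k\<in>F. cmod (fourier_coeff2 g (k - l))))"
      using sum_has by (simp add: has_sum_iff sum_distrib_left)
    also have "\<dots> \<le> (\<Sum>\<^sub>\<infinity>l. cmod (c l) * N)"
    proof (rule infsum_mono[OF s summable_on_cmult_left[OF c]])
      fix l
      have "(\<Sum>k\<in>F. cmod (fourier_coeff2 g (k - l))) \<le> N"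
        unfolding N_def
        using finite_sum_le_infsum[of "\<lambda>k. cmod (fourier_coeff2 g (k - l))" UNIV F] F gs
        by (simp add: infsum_shift[where h = "\<lambda>k. cmod (fourier_coeff2 g k)"])
      then show "cmod (c l) * (\<Sum>k\<in>F. cmod (fourier_coeff2 g (k - l))) \<le> cmod (c l) * N"
        by (simp add: mult_left_mono)
    qed
    also have "\<dots> = ?B"
      by (simp add: infsum_cmult_left' N_def mult.commute)
    finally show ?thesis .
  qed
  show ?S
    by (rule nonneg_bdd_above_summable_on) (auto simp: bdd_above_def intro!: exI[of _ ?B] fin)
  then show "(\<Sum>\<^sub>\<infinity>l. cmod (fourier_coeff2 (\<lambda>\<phi>. g \<phi> * w \<phi>) l)) \<le> ?B"
    by (rule infsum_le_finite_sums) (use fin in auto)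
qed

lemma integrable_torus_mult_bounded:
  fixes g w :: "real \<times> real \<Rightarrow> 'b::{real_normed_field, euclidean_space}"
  assumes "integrable torus g" and "w \<in> borel_measurable borel" and "\<And>\<phi>. norm (w \<phi>) \<le> B"
  shows "integrable torus (\<lambda>\<phi>. g \<phi> * w \<phi>)"
proof (rule Bochner_Integration.integrable_bound)
  show "integrable torus (\<lambda>\<phi>. B * norm (g \<phi>))"
    using assms(1) by simp
  show "(\<lambda>\<phi>. g \<phi> * w \<phi>) \<in> borel_measurable torus"
    by (intro borel_measurable_times borel_measurable_integrable[OF assms(1)] measurable_torus assms(2))
  have "0 \<le> B"
    using assms(3)[of undefined] norm_ge_zero order_trans by blast
  then show "AE \<phi> in torus. norm (g \<phi> * w \<phi>) \<le> norm (B * norm (g \<phi>))"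
    using assms(3) by (intro AE_I2) (simp add: norm_mult mult.commute[of "norm (g _)"] mult_right_mono)
qed

lemma
  fixes c :: "int \<times> int \<Rightarrow> complex" and g w :: "real \<times> real \<Rightarrow> complex"
  assumes c: "(\<lambda>l. cmod (c l)) summable_on UNIV"
    and w: "\<And>\<phi>. ((\<lambda>l. c l * character l \<phi>) has_sum w \<phi>) UNIV"
    and g: "g \<in> borel_measurable borel" "integrable torus g"
    and gs: "(\<lambda>l. cmod (fourier_coeff2 g l)) summable_on UNIV"
  shows summable_coeff_mult_series_power:
      "(\<lambda>l. cmod (fourier_coeff2 (\<lambda>\<phi>. g \<phi> * w \<phi> ^ n) l)) summable_on UNIV"
    and infsum_coeff_mult_series_power:
      "(\<Sum>\<^sub>\<infinity>l. cmod (fourier_coeff2 (\<lambda>\<phi>. g \<phi> * w \<phi> ^ n) l))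
        \<le> (\<Sum>\<^sub>\<infinity>l. cmod (fourier_coeff2 g l)) * (\<Sum>\<^sub>\<infinity>l. cmod (c l)) ^ n"
proof -
  let ?N = "\<lambda>g. \<Sum>\<^sub>\<infinity>l. cmod (fourier_coeff2 g l)" and ?U = "\<Sum>\<^sub>\<infinity>l. cmod (c l)"
  have wm [measurable]: "w \<in> borel_measurable borel"
    by (rule fourier_series_measurable[OF c w])
  \<comment> \<open>Measurability and integrability go into the induction because multiplying by one
    more factor \<open>w\<close> requires them of the product so far.\<close>
  have "(\<lambda>\<phi>. g \<phi> * w \<phi> ^ n) \<in> borel_measurable borel \<and> integrable torus (\<lambda>\<phi>. g \<phi> * w \<phi> ^ n) \<and>
    (\<lambda>l. cmod (fourier_coeff2 (\<lambda>\<phi>. g \<phi> * w \<phi> ^ n) l)) summable_on UNIV \<and>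
    ?N (\<lambda>\<phi>. g \<phi> * w \<phi> ^ n) \<le> ?N g * ?U ^ n"
  proof (induction n)
    case 0
    then show ?case using g gs by simp
  next
    case (Suc n)
    let ?h = "\<lambda>\<phi>. g \<phi> * w \<phi> ^ n"
    have eq: "(\<lambda>\<phi>. g \<phi> * w \<phi> ^ Suc n) = (\<lambda>\<phi>. ?h \<phi> * w \<phi>)"
      by (simp add: ac_simps)
    have "?N (\<lambda>\<phi>. ?h \<phi> * w \<phi>) \<le> ?N ?h * ?U"
      using Suc by (intro infsum_coeff_mult_series[OF c w]) auto
    also have "\<dots> \<le> ?N g * ?U ^ n * ?U"
      using Suc by (intro mult_right_mono infsum_nonneg) auto
    finally have "?N (\<lambda>\<phi>. ?h \<phi> * w \<phi>) \<le> ?N g * ?U ^ Suc n"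
      by (simp add: ac_simps)
    moreover have "(\<lambda>l. cmod (fourier_coeff2 (\<lambda>\<phi>. ?h \<phi> * w \<phi>) l)) summable_on UNIV"
      using Suc by (intro summable_coeff_mult_series[OF c w]) auto
    moreover have "integrable torus (\<lambda>\<phi>. ?h \<phi> * w \<phi>)"
      using Suc by (intro integrable_torus_mult_bounded[OF _ wm fourier_series_bound[OF c w]]) auto
    moreover have "(\<lambda>\<phi>. ?h \<phi> * w \<phi>) \<in> borel_measurable borel"
      using Suc by auto
    ultimately show ?case
      unfolding eq by blast
  qed
  then show "(\<lambda>l. cmod (fourier_coeff2 (\<lambda>\<phi>. g \<phi> * w \<phi> ^ n) l)) summable_on UNIV"
    and "?N (\<lambda>\<phi>. g \<phi> * w \<phi> ^ n) \<le> ?N g * ?U ^ n"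
    by blast+
qed

section \<open>Fourier coefficients of the factor depending on the first angle\<close>

lemma integral_circle_cis:
  "(\<integral>x. cis (- (of_int k * x)) \<partial>circle) = (if k = 0 then of_real (2 * pi) else 0)"
proof (cases "k = 0")
  case True
  then show ?thesis
    using measure_circle by (simp add: scaleR_conv_of_real)
next
  case False
  let ?F = "\<lambda>x::real. cis (- (of_int k * x)) / (- \<i> * of_int k)"
  have "(\<integral>x. cis (- (of_int k * x)) \<partial>circle)
      = (\<integral>x. indicator {0..2 * pi} x *\<^sub>R cis (- (of_int k * x)) \<partial>lborel)"
    by (simp add: circle_def integral_restrict_space)
  also have "\<dots> = ?F (2 * pi) - ?F 0"
  proof (rule integral_FTC_Icc)
    fix x :: real
    show "(?F has_vector_derivative cis (- (of_int k * x))) (at x within {0..2 * pi})"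
    proof -
      have "((\<lambda>z. exp (- \<i> * of_int k * z) / (- \<i> * of_int k)) has_field_derivative
          exp (- \<i> * of_int k * of_real x)) (at (of_real x))"
        using False by (auto intro!: derivative_eq_intros)
      from has_vector_derivative_real_field[OF this, of "{0..2 * pi}"] show ?thesis
        by (simp add: cis_conv_exp mult.assoc)
    qed
    show "continuous_on {0..2 * pi} (\<lambda>x. cis (- (of_int k * x)))"
      by (intro continuous_intros)
  qed simp
  also have "cis (- (of_int k * (2 * pi))) = 1"
    using cos_int_2pin[of k] sin_int_2pin[of k] by (simp add: complex_eq_iff ac_simps)
  finally show ?thesis
    using False by simp
qed

lemma summable_on_inverse_square_int:
  "(\<lambda>k::int. 1 / (1 + (of_int k)\<^sup>2) :: real) summable_on UNIV"
proof -
  let ?f = "\<lambda>k::int. 1 / (1 + (of_int k)\<^sup>2) :: real"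
  have "summable (\<lambda>n. 1 / (1 + (real n)\<^sup>2))"
    by (rule summable_comparison_test'[OF inverse_power_summable[of 2], where N = 1])
       (auto simp: inverse_eq_divide intro!: divide_left_mono mult_pos_pos add_pos_nonneg)
  then have nat: "(\<lambda>n. 1 / (1 + (real n)\<^sup>2)) summable_on UNIV"
    by (simp add: summable_on_UNIV_nonneg_real_iff)
  have "?f summable_on range int" "?f summable_on range (\<lambda>n. - int n)"
    using nat by (subst summable_on_reindex; simp add: inj_on_def o_def)+
  moreover have "UNIV = range int \<union> range (\<lambda>n. - int n)"
    by (auto simp: image_iff) (metis int_cases2)
  ultimately show ?thesis
    using summable_on_union by metis
qed

text \<open>In place of the Cauchy-Schwarz inequality, the termwise inequality
  \<open>2 * cmod (c k) \<le> t * (cmod (c k))\<^sup>2 + 1 / t\<close> with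
  \<open>t = 1 + k\<^sup>2\<close> is summed over \<open>k\<close>; \<open>s \<ge> 1\<close> bounds
  \<open>t\<close> by \<open>t powr s\<close>.\<close>

lemma sobolev_coeff_summable:
  fixes c :: "int \<Rightarrow> complex"
  assumes s: "s \<ge> 1"
    and c: "(\<lambda>k::int. (1 + (of_int k)\<^sup>2) powr s * (cmod (c k))\<^sup>2) summable_on UNIV"
  shows "(\<lambda>k. cmod (c k)) summable_on UNIV"
proof (rule summable_on_comparison_test)
  show "(\<lambda>k::int. (1 + (of_int k)\<^sup>2) powr s * (cmod (c k))\<^sup>2 + 1 / (1 + (of_int k)\<^sup>2)) summable_on UNIV"
    by (rule summable_on_add[OF c summable_on_inverse_square_int])
  fix k :: int
  define t where "t = 1 + (real_of_int k)\<^sup>2"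
  have t: "t \<ge> 1" by (simp add: t_def)
  have "2 * cmod (c k) \<le> t * (cmod (c k))\<^sup>2 + 1 / t"
  proof -
    have "0 \<le> (t * cmod (c k) - 1)\<^sup>2 / t"
      using t by simp
    also have "\<dots> = t * (cmod (c k))\<^sup>2 + 1 / t - 2 * cmod (c k)"
      using t by (simp add: field_simps power2_eq_square)
    finally show ?thesis by simp
  qed
  moreover have "t * (cmod (c k))\<^sup>2 \<le> t powr s * (cmod (c k))\<^sup>2"
    using powr_mono[OF s t] t by (intro mult_right_mono) simp_all
  ultimately have "cmod (c k) \<le> t powr s * (cmod (c k))\<^sup>2 + 1 / t"
    using norm_ge_zero[of "c k"] by linarith
  then show "cmod (c k) \<le> (1 + (of_int k)\<^sup>2) powr s * (cmod (c k))\<^sup>2 + 1 / (1 + (of_int k)\<^sup>2)"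
    by (simp add: t_def)
qed simp

text \<open>Fubini separates the angles, and the integral over the second one vanishes unless
  \<open>snd l = 0\<close>.\<close>

lemma fourier_coeff2_fst:
  assumes b: "b \<in> borel_measurable borel" and int: "integrable circle b"
  shows "fourier_coeff2 (\<lambda>\<phi>. b (fst \<phi>)) l = (if snd l = 0 then fourier_coeff b (fst l) else 0)"
proof -
  let ?g = "\<lambda>x. b x * cis (- (of_int (fst l) * x))" and ?h = "\<lambda>y. cis (- (of_int (snd l) * y))"
  have g: "integrable circle ?g"
    by (rule Bochner_Integration.integrable_bound[OF int])
       (use b in \<open>auto simp: norm_mult intro: measurable_circle\<close>)
  have h: "integrable circle ?h"
    by (rule finite_measure.integrable_const_bound[OF finite_measure_circle, where B = 1])
       (auto intro: measurable_circle)
  have "(\<lambda>\<phi>. b (fst \<phi>) * cis (- (of_int (fst l) * fst \<phi> + of_int (snd l) * snd \<phi>)))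
      = (\<lambda>\<phi>. ?g (fst \<phi>) * ?h (snd \<phi>))"
    by (simp add: mult.assoc cis_mult)
  then have "fourier_coeff2 (\<lambda>\<phi>. b (fst \<phi>)) l
      = (\<integral>\<phi>. ?g (fst \<phi>) * ?h (snd \<phi>) \<partial>torus) / of_real ((2 * pi)\<^sup>2)"
    using b by (subst fourier_coeff2_AE[of "\<lambda>\<phi>. b (fst \<phi>)"]) simp_all
  also have "\<dots> = integral\<^sup>L circle ?g * (if snd l = 0 then of_real (2 * pi) else 0) / of_real ((2 * pi)\<^sup>2)"
    by (subst integral_torus_product[OF g h]) (simp only: integral_circle_cis)
  also have "\<dots> = (if snd l = 0 then fourier_coeff b (fst l) else 0)"
    using b by (simp add: fourier_coeff_AE[of b] power2_eq_square)
  finally show ?thesis .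
qed

lemma coeff_fst_abs_summable:
  assumes b: "b \<in> borel_measurable borel" and int: "integrable circle b"
    and s: "(\<lambda>k. cmod (fourier_coeff b k)) summable_on UNIV"
  shows "(\<lambda>l. cmod (fourier_coeff2 (\<lambda>\<phi>. b (fst \<phi>)) l)) summable_on UNIV"
proof -
  have "(\<lambda>l. cmod (fourier_coeff2 (\<lambda>\<phi>. b (fst \<phi>)) l)) summable_on range (\<lambda>k. (k, 0))"
    using s by (subst summable_on_reindex) (auto simp: inj_on_def o_def fourier_coeff2_fst[OF b int])
  also have "?this \<longleftrightarrow> ?thesis"
    by (rule summable_on_cong_neutral) (auto simp: fourier_coeff2_fst[OF b int] image_iff prod_eq_iff)
  finally show ?thesis .
qed

section \<open>Lower bounds for the symbol\<close>

text \<open>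
  For \<open>\<omega>2 = 1 + \<epsilon>\<close> we have \<open>\<omega>2\<^sup>2 - 1 = \<epsilon> (2 + \<epsilon>)\<close> and \<open>2 \<omega>2 = \<epsilon> + (2 + \<epsilon>)\<close>, so that the two factors below
  are those of the Diophantine conditions.
\<close>

lemma wave_symbol_factor:
  "wave_symbol \<omega>1 (1 + \<epsilon>) l =
     - of_real ((\<omega>1 * of_int (fst l) + \<epsilon> * of_int (snd l)) *
                (\<omega>1 * of_int (fst l) + (2 + \<epsilon>) * of_int (snd l)))"
  by (simp add: wave_symbol_def power_mult_distrib power2_eq_square algebra_simps)

text \<open>
  With \<open>w = \<omega>1 l1\<close>, \<open>x = l1\<close> and \<open>z = l2\<close>: the two factors cannot be small simultaneously, the larger one
  being at least \<open>(\<bar>x\<bar> + \<bar>z\<bar>) / 3\<close>, and this compensates the loss in the Diophantine condition.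
\<close>

lemma abs_mult_lower_bound:
  fixes x y z w \<epsilon> \<gamma> :: real
  assumes "\<bar>\<epsilon>\<bar> \<le> 1 / 2" and "\<gamma> > 0" and z: "\<bar>z\<bar> \<ge> 1" and xz: "\<bar>x\<bar> \<le> \<bar>w\<bar>"
    and A: "\<bar>w + \<epsilon> * z\<bar> > \<gamma> / (\<bar>x\<bar> + \<bar>z\<bar>)"
    and B: "\<bar>w + (2 + \<epsilon>) * z\<bar> > \<gamma> / (\<bar>x\<bar> + \<bar>z\<bar>)"
  shows "\<gamma> / 3 \<le> \<bar>(w + \<epsilon> * z) * (w + (2 + \<epsilon>) * z)\<bar>"
proof -
  define a where "a = \<bar>w + \<epsilon> * z\<bar>"
  define b where "b = \<bar>w + (2 + \<epsilon>) * z\<bar>"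
  define n where "n = \<bar>x\<bar> + \<bar>z\<bar>"
  have n: "n > 0" using z by (simp add: n_def)
  have "(w + (2 + \<epsilon>) * z) - (w + \<epsilon> * z) = 2 * z"
    by (simp add: algebra_simps)
  then have zm: "\<bar>z\<bar> \<le> max a b"
    unfolding a_def b_def by linarith
  have "\<bar>\<epsilon> * z\<bar> \<le> \<bar>z\<bar> / 2"
    using mult_right_mono[OF assms(1), of "\<bar>z\<bar>"] by (simp add: abs_mult)
  then have wa: "\<bar>w\<bar> \<le> a + \<bar>z\<bar> / 2"
    unfolding a_def by linarith
  \<comment> \<open>The chain is \<open>\<bar>x\<bar> + \<bar>z\<bar> \<le> a + 3 / 2 *
    \<bar>z\<bar> \<le> 5 / 2 * max a b\<close>.\<close>
  have "n \<le> 3 * max a b"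
    using z zm xz wa max.cobounded1[of a b] unfolding n_def by linarith
  then have m: "n / 3 \<le> max a b"
    by simp
  have mn: "\<gamma> / n \<le> min a b"
    using A B unfolding a_def b_def n_def by (intro min.boundedI less_imp_le)
  have "0 \<le> min a b" "0 \<le> n / 3"
    using n by (simp_all add: a_def b_def)
  from mult_mono[OF mn m this] have "\<gamma> / 3 \<le> min a b * max a b"
    using n by simp
  also have "min a b * max a b = a * b"
    by (simp add: min_def max_def)
  finally show ?thesis
    unfolding a_def b_def abs_mult .
qed

text \<open>The Diophantine conditions do not cover \<open>snd l = 0\<close>, but there the modulus
  is \<open>(\<omega>1 * l1)\<^sup>2 \<ge> 1\<close>, and \<open>\<gamma> \<le> 3\<close> suffices.
  Otherwise the preceding inequality applies with \<open>w = \<omega>1 * l1\<close>, where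
  \<open>\<omega>1 > 1\<close> gives \<open>\<bar>x\<bar> \<le> \<bar>w\<bar>\<close>.\<close>

lemma wave_symbol_ge:
  assumes dio: "(\<epsilon>, \<omega>1) \<in> diophantine_set \<epsilon>0 \<gamma>" and \<gamma>: "0 < \<gamma>" "\<gamma> \<le> 3"
    and \<epsilon>: "\<bar>\<epsilon>\<bar> \<le> 1 / 2" and l: "fst l \<noteq> 0"
  shows "\<gamma> / 3 \<le> cmod (wave_symbol \<omega>1 (1 + \<epsilon>) l)"
proof -
  obtain l1 l2 where l12: "l = (l1, l2)" by (cases l)
  have \<omega>: "1 < \<omega>1" using dio by (auto simp: diophantine_set_def)
  have l1: "\<bar>real_of_int l1\<bar> \<ge> 1" using l l12 by simp
  have big: "\<bar>real_of_int l1\<bar> \<le> \<bar>\<omega>1 * of_int l1\<bar>"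
    using \<omega> mult_right_mono[of 1 \<omega>1 "\<bar>real_of_int l1\<bar>"] by (simp add: abs_mult)
  have "\<gamma> / 3 \<le> \<bar>(\<omega>1 * of_int l1 + \<epsilon> * of_int l2) * (\<omega>1 * of_int l1 + (2 + \<epsilon>) * of_int l2)\<bar>"
  proof (cases "l2 = 0")
    case True
    have "1 * 1 \<le> \<bar>\<omega>1 * of_int l1\<bar> * \<bar>\<omega>1 * of_int l1\<bar>"
      using big l1 by (intro mult_mono) linarith+
    then show ?thesis
      using True \<gamma> by (simp add: abs_mult)
  next
    case False
    have "l1 \<noteq> 0"
      using l l12 by simp
    then have "\<bar>\<omega>1 * of_int l1 + \<epsilon> * of_int l2\<bar> > \<gamma> / of_int (\<bar>l1\<bar> + \<bar>l2\<bar>) \<and>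
        \<bar>\<omega>1 * of_int l1 + (2 + \<epsilon>) * of_int l2\<bar> > \<gamma> / of_int (\<bar>l1\<bar> + \<bar>l2\<bar>)"
      using dio False unfolding diophantine_set_def by blast
    then have "\<gamma> / (\<bar>of_int l1\<bar> + \<bar>of_int l2\<bar>) < \<bar>\<omega>1 * of_int l1 + \<epsilon> * of_int l2\<bar>"
      "\<gamma> / (\<bar>of_int l1\<bar> + \<bar>of_int l2\<bar>) < \<bar>\<omega>1 * of_int l1 + (2 + \<epsilon>) * of_int l2\<bar>"
      by (simp_all only: of_int_add of_int_abs)
    moreover have "1 \<le> \<bar>real_of_int l2\<bar>"
      using False by simp
    ultimately show ?thesis
      by (intro abs_mult_lower_bound[OF \<epsilon> \<gamma>(1) _ big])
  qed
  then show ?thesis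
    by (simp only: wave_symbol_factor l12 fst_conv snd_conv norm_minus_cancel norm_of_real)
qed

text \<open>Here the symbol is \<open>- \<epsilon> * (2 + \<epsilon>) * l2\<^sup>2\<close>. It
  degenerates as \<epsilon> tends to 0, but its growth in \<open>l2\<close> later controls the
  tail.\<close>

lemma wave_symbol_fst_0_ge:
  assumes "\<bar>\<epsilon>\<bar> \<le> 1 / 2" and "fst l = 0"
  shows "\<bar>\<epsilon>\<bar> * (of_int (snd l))\<^sup>2 \<le> cmod (wave_symbol \<omega>1 (1 + \<epsilon>) l)"
proof -
  have "cmod (wave_symbol \<omega>1 (1 + \<epsilon>) l) = \<bar>\<epsilon>\<bar> * (of_int (snd l))\<^sup>2 * (2 + \<epsilon>)"
    unfolding wave_symbol_factor norm_minus_cancel norm_of_real using assms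
    by (simp add: abs_mult power2_eq_square)
  moreover have "\<bar>\<epsilon>\<bar> * (of_int (snd l))\<^sup>2 * 1 \<le> \<bar>\<epsilon>\<bar> * (of_int (snd l))\<^sup>2 * (2 + \<epsilon>)"
    using assms by (intro mult_left_mono) auto
  ultimately show ?thesis by simp
qed

section \<open>Lower bound for the mean of an even power\<close>

text \<open>Jensen's inequality for \<open>\<bar>f\<bar>\<close>, with
  \<open>f x ^ D = \<bar>f x\<bar> ^ D\<close> by evenness. Any lower bound \<open>m\<close> of the
  mean may be used, as the tangent at \<open>m\<close> has nonnegative slope; its formula divides by
  \<open>m\<close>, so \<open>m = 0\<close> is treated separately.\<close>

lemma mean_power_le:
  fixes f :: "'a \<Rightarrow> real"
  assumes M: "finite_measure M" "measure M (space M) > 0" and D: "even D"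
    and f: "integrable M f" "integrable M (\<lambda>x. f x ^ D)"
    and m: "0 \<le> m" "m * measure M (space M) \<le> (\<integral>x. \<bar>f x\<bar> \<partial>M)"
  shows "m ^ D * measure M (space M) \<le> (\<integral>x. f x ^ D \<partial>M)"
proof (cases "m = 0")
  case True
  have "0 \<le> (\<integral>x. f x ^ D \<partial>M)"
    by (intro integral_nonneg_AE AE_I2 zero_le_even_power D)
  then show ?thesis
    using True M f(2) by (cases "D = 0") (auto simp: power_0_left)
next
  case False
  interpret finite_measure M by fact
  have pos: "m > 0" using m False by simp
  \<comment> \<open>the tangent at \<open>m\<close> of the convex function \<open>t \<mapsto> t ^ D\<close>, evaluated at \<open>\<bar>f x\<bar>\<close>\<close>
  let ?g = "\<lambda>x. m ^ D * (1 - real D) + m ^ D * real D / m * \<bar>f x\<bar>"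
  have "?g x \<le> f x ^ D" for x
  proof -
    have "m ^ D * (1 + real D * (\<bar>f x\<bar> / m - 1)) \<le> m ^ D * (1 + (\<bar>f x\<bar> / m - 1)) ^ D"
      using pos by (intro mult_left_mono Bernoulli_inequality_even D) simp
    also have "\<dots> = f x ^ D"
      using pos D by (simp add: power_divide power_even_abs)
    finally show ?thesis by (simp add: algebra_simps)
  qed
  then have "integral\<^sup>L M ?g \<le> (\<integral>x. f x ^ D \<partial>M)"
    using f by (intro integral_mono) auto
  moreover have "integral\<^sup>L M ?g = m ^ D * (1 - real D) * measure M (space M) + m ^ D * real D / m * (\<integral>x. \<bar>f x\<bar> \<partial>M)"
    using f by simp
  moreover have "m ^ D * real D / m * (m * measure M (space M)) \<le> m ^ D * real D / m * (\<integral>x. \<bar>f x\<bar> \<partial>M)"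
    using m pos by (intro mult_left_mono) auto
  ultimately show ?thesis
    using pos by (simp add: algebra_simps)
qed

text \<open>Dividing by \<open>U\<close> reduces to the unit ball, where
  \<open>t \<mapsto> t ^ D\<close> has Lipschitz constant \<open>D\<close>.\<close>

lemma abs_power_diff_le:
  fixes x y :: real
  assumes "\<bar>x\<bar> \<le> U" "\<bar>y\<bar> \<le> U" "D > 0"
  shows "\<bar>x ^ D - y ^ D\<bar> \<le> real D * U ^ (D - 1) * \<bar>x - y\<bar>"
proof (cases "U = 0")
  case False
  then have U: "U > 0" using assms by linarith
  have "norm (x / U) \<le> 1" "norm (y / U) \<le> 1"
    using assms U by simp_all
  from norm_power_diff[OF this, of D]
  have "\<bar>(x / U) ^ D - (y / U) ^ D\<bar> \<le> real D * \<bar>x / U - y / U\<bar>"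
    by (simp only: real_norm_def)
  then have "\<bar>x ^ D - y ^ D\<bar> / U ^ D \<le> real D * \<bar>x - y\<bar> / U"
    using U by (simp add: power_divide diff_divide_distrib[symmetric])
  then have "\<bar>x ^ D - y ^ D\<bar> \<le> real D * \<bar>x - y\<bar> / U * U ^ D"
    by (simp only: pos_divide_le_eq U zero_less_power)
  also have "U ^ D = U ^ (D - 1) * U"
    using power_minus_mult[OF \<open>D > 0\<close>, of U] by simp
  finally show ?thesis
    using U by (simp add: mult_ac)
qed (use assms in auto)

text \<open>Let \<open>q\<close> be the part of \<open>u\<close> with \<open>fst l = 0\<close>. As
  \<open>a * u ^ D\<close> has integral zero, that of \<open>a * q ^ D\<close> equals that of
  \<open>a * (q ^ D - u ^ D)\<close>. By Fubini the former is the product of the integrals of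
  \<open>a\<close> and \<open>q ^ D\<close>, and Jensen's inequality bounds the second factor from
  below; the latter is of order \<open>P\<close> by the Lipschitz bound.\<close>

lemma integral_power_lower_bound:
  fixes a :: "real \<Rightarrow> real" and u :: "real \<times> real \<Rightarrow> real" and c :: "int \<times> int \<Rightarrow> complex"
  defines "U \<equiv> \<Sum>\<^sub>\<infinity>l. cmod (c l)"
    and "P \<equiv> \<Sum>\<^sub>\<infinity>l. if fst l = 0 then 0 else cmod (c l)"
  assumes a: "a \<in> borel_measurable borel" "integrable circle a"
    and c: "(\<lambda>l. cmod (c l)) summable_on UNIV"
    and u: "\<And>\<phi>. ((\<lambda>l. c l * character l \<phi>) has_sum of_real (u \<phi>)) UNIV"
    and zero: "(\<integral>\<phi>. a (fst \<phi>) * u \<phi> ^ D \<partial>torus) = 0"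
    and D: "even D" "D > 0"
    and l0: "fourier_coeff2 (\<lambda>\<phi>. of_real (u \<phi>)) l0 = c l0" "P \<le> cmod (c l0)"
  shows "\<bar>integral\<^sup>L circle a\<bar> * (cmod (c l0) - P) ^ D
           \<le> (\<integral>x. \<bar>a x\<bar> \<partial>circle) * (real D * U ^ (D - 1) * P)"
proof -
  \<comment> \<open>\<open>q\<close> is the part of \<open>u\<close> depending on the second angle only, and \<open>P\<close> bounds the rest\<close>
  define c' where "c' l = (if fst l = 0 then c l else 0)" for l
  define W where "W \<phi> = (\<Sum>\<^sub>\<infinity>l. c' l * character l \<phi>)" for \<phi>
  \<comment> \<open>\<open>W\<close> depends on the second angle alone, so it can be evaluated at
    \<open>(0, y)\<close>. Taking the real part does not spoil the comparison with \<open>u\<close>,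
    which is real.\<close>
  define q where "q y = Re (W (0, y))" for y
  have c': "(\<lambda>l. cmod (c' l)) summable_on UNIV"
    by (rule summable_on_comparison_test[OF c]) (auto simp: c'_def)
  have W: "((\<lambda>l. c' l * character l \<phi>) has_sum W \<phi>) UNIV" for \<phi>
    unfolding W_def
    by (rule has_sum_infsum[OF abs_summable_summable]) (use c' in \<open>simp add: norm_mult\<close>)
  have W_snd: "W \<phi> = W (0, snd \<phi>)" for \<phi>
    unfolding W_def by (intro infsum_cong) (simp add: c'_def)
  have [measurable]: "W \<in> borel_measurable borel"
    by (rule fourier_series_measurable[OF c' W])
  have "(\<lambda>y::real. (0::real, y)) \<in> borel_measurable borel"
    by (intro borel_measurable_continuous_onI continuous_intros)
  then have [measurable]: "q \<in> borel_measurable borel"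
    unfolding q_def by measurable
  have uc [measurable]: "(\<lambda>\<phi>. complex_of_real (u \<phi>)) \<in> borel_measurable borel"
    by (rule fourier_series_measurable[OF c u])
  have "(\<lambda>\<phi>. Re (complex_of_real (u \<phi>))) \<in> borel_measurable borel"
    by measurable
  then have um [measurable]: "u \<in> borel_measurable borel"
    by simp
  note [measurable] = a(1)
  have uU: "\<bar>u \<phi>\<bar> \<le> U" for \<phi>
    using fourier_series_bound[OF c u, of \<phi>] by (simp add: U_def)
  have qU: "\<bar>q y\<bar> \<le> U" for y
  proof -
    have "\<bar>q y\<bar> \<le> (\<Sum>\<^sub>\<infinity>l. cmod (c' l))"
      using fourier_series_bound[OF c' W] abs_Re_le_cmod order_trans unfolding q_def by blast
    also have "\<dots> \<le> U"
      unfolding U_def by (rule infsum_mono[OF c' c]) (simp add: c'_def)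
    finally show ?thesis .
  qed
  have U0: "U \<ge> 0"
    by (simp add: U_def infsum_nonneg)
  have uq: "\<bar>u \<phi> - q (snd \<phi>)\<bar> \<le> P" for \<phi>
  proof -
    have "((\<lambda>l. - (c' l * character l \<phi>)) has_sum - W \<phi>) UNIV"
      using W by (simp add: has_sum_uminus)
    from has_sum_add[OF u this]
    have "((\<lambda>l. c l * character l \<phi> - c' l * character l \<phi>) has_sum (of_real (u \<phi>) - W \<phi>)) UNIV"
      by simp
    moreover have "(\<lambda>l. if fst l = 0 then 0 else cmod (c l)) summable_on UNIV"
      by (rule summable_on_comparison_test[OF c]) auto
    ultimately have "cmod (of_real (u \<phi>) - W \<phi>) \<le> P"
      unfolding P_def by (intro norm_infsum_le[OF _ has_sum_infsum]) (auto simp: c'_def norm_mult)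
    moreover have "\<bar>u \<phi> - q (snd \<phi>)\<bar> \<le> cmod (of_real (u \<phi>) - W \<phi>)"
      using abs_Re_le_cmod[of "of_real (u \<phi>) - W \<phi>"] by (simp add: q_def W_snd[of \<phi>])
    ultimately show ?thesis by simp
  qed
  interpret finite_measure torus by (rule finite_measure_torus)
  let ?T = "(2 * pi)\<^sup>2"
  have one: "integrable circle (\<lambda>_. 1 :: real)"
    using finite_measure_circle by (simp add: finite_measure.integrable_const)
  have af: "integrable torus (\<lambda>\<phi>. a (fst \<phi>))"
    using integrable_torus_product[OF a(2) one] by simp
  have bounded_int: "integrable torus f" if "f \<in> borel_measurable borel" "\<And>\<phi>. \<bar>f \<phi>\<bar> \<le> B" for B and f :: "_ \<Rightarrow> real"
    using that by (intro integrable_const_bound[where B = B]) (auto intro: measurable_torus)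
  have power_bound: "\<bar>x ^ D\<bar> \<le> U ^ D" if "\<bar>x\<bar> \<le> U" for x :: real
    using that by (simp add: power_abs power_mono)
  have "integrable torus u" and qi: "integrable torus (\<lambda>\<phi>. q (snd \<phi>))"
    by (rule bounded_int[where B = U]; simp add: uU qU)+
  have qDi: "integrable torus (\<lambda>\<phi>. q (snd \<phi>) ^ D)"
    by (rule bounded_int[where B = "U ^ D"]; simp add: power_bound qU)
  have "integrable circle (\<lambda>y. q y ^ D)"
    by (rule finite_measure.integrable_const_bound[OF finite_measure_circle, where B = "U ^ D"])
       (auto simp: power_bound qU intro: measurable_circle)
  note product = integral_torus_product[OF one this] integral_torus_product[OF a(2) this]
  define m where "m = cmod (c l0) - P"
  have m0: "0 \<le> m" using l0 by (simp add: m_def)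
  \<comment> \<open>A coefficient of \<open>u\<close> is at most the mean of
    \<open>\<bar>u\<bar>\<close>, which exceeds that of \<open>\<bar>q\<bar>\<close> by at most
    \<open>P\<close>; so \<open>m\<close> is a lower bound for the mean of
    \<open>\<bar>q\<bar>\<close>.\<close>
  have "cmod (c l0) * ?T = cmod (\<integral>\<phi>. of_real (u \<phi>) * character (- l0) \<phi> \<partial>torus)"
    unfolding l0(1)[symmetric] fourier_coeff2_borel[OF uc] by (simp add: norm_divide norm_mult norm_power)
  also have "\<dots> \<le> (\<integral>\<phi>. \<bar>u \<phi>\<bar> \<partial>torus)"
    using integral_norm_bound[of torus "\<lambda>\<phi>. of_real (u \<phi>) * character (- l0) \<phi>"] by (simp add: norm_mult)
  also have "\<dots> \<le> (\<integral>\<phi>. \<bar>q (snd \<phi>)\<bar> + P \<partial>torus)"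
  proof (rule integral_mono)
    show "\<bar>u \<phi>\<bar> \<le> \<bar>q (snd \<phi>)\<bar> + P" for \<phi>
      using uq[of \<phi>] by linarith
  qed (use \<open>integrable torus u\<close> qi in auto)
  also have "\<dots> = (\<integral>\<phi>. \<bar>q (snd \<phi>)\<bar> \<partial>torus) + P * ?T"
    using qi by (simp add: measure_torus)
  finally have "m * ?T \<le> (\<integral>\<phi>. \<bar>q (snd \<phi>)\<bar> \<partial>torus)"
    by (simp add: m_def left_diff_distrib)
  then have "m ^ D * ?T \<le> (\<integral>\<phi>. q (snd \<phi>) ^ D \<partial>torus)"
    using mean_power_le[OF finite_measure_torus _ D(1) qi qDi m0] by (simp add: measure_torus)
  also have "\<dots> = 2 * pi * (\<integral>y. q y ^ D \<partial>circle)"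
    using product(1) measure_circle by simp
  finally have "\<bar>integral\<^sup>L circle a\<bar> * (m ^ D * ?T) \<le> \<bar>integral\<^sup>L circle a\<bar> * (2 * pi * (\<integral>y. q y ^ D \<partial>circle))"
    by (rule mult_left_mono) simp
  \<comment> \<open>Evenness makes this integral nonnegative, so that the two factors combine to the
    modulus of a single integral over the torus.\<close>
  also have "(\<integral>y. q y ^ D \<partial>circle) = \<bar>\<integral>y. q y ^ D \<partial>circle\<bar>"
    using D by (simp add: integral_nonneg_AE zero_le_even_power)
  finally have 1: "\<bar>integral\<^sup>L circle a\<bar> * (m ^ D * ?T) \<le> 2 * pi * \<bar>\<integral>\<phi>. a (fst \<phi>) * q (snd \<phi>) ^ D \<partial>torus\<bar>"
    unfolding product(2) by (simp add: abs_mult ac_simps)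
  have aui: "integrable torus (\<lambda>\<phi>. a (fst \<phi>) * u \<phi> ^ D)"
    and aqi: "integrable torus (\<lambda>\<phi>. a (fst \<phi>) * q (snd \<phi>) ^ D)"
    by (rule integrable_torus_mult_bounded[OF af, where B = "U ^ D"]; simp add: power_bound uU qU)+
  let ?C = "real D * U ^ (D - 1) * P"
  have "\<bar>\<integral>\<phi>. a (fst \<phi>) * q (snd \<phi>) ^ D \<partial>torus\<bar>
      = \<bar>\<integral>\<phi>. a (fst \<phi>) * q (snd \<phi>) ^ D - a (fst \<phi>) * u \<phi> ^ D \<partial>torus\<bar>"
    using aui aqi zero by simp
  also have "\<dots> \<le> (\<integral>\<phi>. \<bar>a (fst \<phi>)\<bar> * ?C \<partial>torus)"
  proof (rule integral_abs_bound_integral)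
    fix \<phi>
    have "\<bar>q (snd \<phi>) ^ D - u \<phi> ^ D\<bar> \<le> real D * U ^ (D - 1) * \<bar>q (snd \<phi>) - u \<phi>\<bar>"
      by (rule abs_power_diff_le[OF qU uU D(2)])
    also have "\<dots> \<le> ?C"
      using uq[of \<phi>] U0 by (intro mult_left_mono) (auto simp: abs_minus_commute)
    finally show "\<bar>a (fst \<phi>) * q (snd \<phi>) ^ D - a (fst \<phi>) * u \<phi> ^ D\<bar> \<le> \<bar>a (fst \<phi>)\<bar> * ?C"
      unfolding right_diff_distrib[symmetric] abs_mult by (rule mult_left_mono) simp
  qed (use aui aqi af in auto)
  also have "\<dots> = 2 * pi * (\<integral>x. \<bar>a x\<bar> \<partial>circle) * ?C"
    using integral_torus_product[OF integrable_abs[OF a(2)] one] measure_circle by simp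
  finally have "2 * pi * \<bar>\<integral>\<phi>. a (fst \<phi>) * q (snd \<phi>) ^ D \<partial>torus\<bar> \<le> 2 * pi * (2 * pi * (\<integral>x. \<bar>a x\<bar> \<partial>circle) * ?C)"
    by (rule mult_left_mono) simp
  from order_trans[OF 1 this] have "?T * (\<bar>integral\<^sup>L circle a\<bar> * m ^ D) \<le> ?T * ((\<integral>x. \<bar>a x\<bar> \<partial>circle) * ?C)"
    by (simp only: power2_eq_square mult_ac)
  then show ?thesis
    unfolding m_def by (subst (asm) mult_le_cancel_left_pos) auto
qed

section \<open>Splitting the modes of a solution\<close>

text \<open>The modes are split into \<open>fst l \<noteq> 0\<close> (\<open>p\<close>) and, on the
  axis \<open>fst l = 0\<close>, the tail \<open>\<bar>snd l\<bar> > n\<close> (\<open>t\<close>)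
  and the rest (\<open>r\<close>). The two bounds by \<open>F\<close> control \<open>p\<close> and
  \<open>t\<close>; \<open>r\<close> lives on \<open>2 * n + 1\<close> modes, the largest of which
  is at least the average.\<close>

lemma
  fixes c F :: "int \<times> int \<Rightarrow> complex"
  assumes c: "(\<lambda>l. cmod (c l)) summable_on UNIV"
    and F: "(\<lambda>l. cmod (F l)) summable_on UNIV"
    and high: "\<And>l. fst l \<noteq> 0 \<Longrightarrow> \<alpha> * cmod (c l) \<le> cmod (F l)"
    and low: "\<And>l. fst l = 0 \<Longrightarrow> \<beta> * (of_int (snd l))\<^sup>2 * cmod (c l) \<le> cmod (F l)"
    and pos: "\<alpha> > 0" "\<beta> > 0" "n > 0"
  shows high_modes_le: "(\<Sum>\<^sub>\<infinity>l. if fst l = 0 then 0 else cmod (c l)) \<le> (\<Sum>\<^sub>\<infinity>l. cmod (F l)) / \<alpha>"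
    and exists_large_low_mode: "\<exists>l. fst l = 0 \<and> (\<Sum>\<^sub>\<infinity>l. cmod (c l)) - (\<Sum>\<^sub>\<infinity>l. cmod (F l)) / \<alpha>
           - (\<Sum>\<^sub>\<infinity>l. cmod (F l)) / (\<beta> * (real n)\<^sup>2) \<le> (2 * real n + 1) * cmod (c l)"
proof -
  let ?S = "\<Sum>\<^sub>\<infinity>l. cmod (F l)"
  define p where "p l = (if fst l = 0 then 0 else cmod (c l))" for l
  define t where "t l = (if fst l = 0 \<and> int n < \<bar>snd l\<bar> then cmod (c l) else 0)" for l
  define r where "r l = (if fst l = 0 \<and> \<bar>snd l\<bar> \<le> int n then cmod (c l) else 0)" for l
  have sums: "p summable_on UNIV" "t summable_on UNIV" "r summable_on UNIV"
    by (rule summable_on_comparison_test[OF c]; simp add: p_def t_def r_def)+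
  have "infsum p UNIV \<le> (\<Sum>\<^sub>\<infinity>l. cmod (F l) * (1 / \<alpha>))"
  proof (rule infsum_mono[OF sums(1) summable_on_cmult_left[OF F]])
    show "p l \<le> cmod (F l) * (1 / \<alpha>)" for l
      using high[of l] pos by (simp add: p_def field_simps)
  qed
  then have P: "infsum p UNIV \<le> ?S / \<alpha>"
    by (subst (asm) infsum_cmult_left') simp
  then show "(\<Sum>\<^sub>\<infinity>l. if fst l = 0 then 0 else cmod (c l)) \<le> ?S / \<alpha>"
    by (simp add: p_def[abs_def])
  have "infsum t UNIV \<le> (\<Sum>\<^sub>\<infinity>l. cmod (F l) * (1 / (\<beta> * (real n)\<^sup>2)))"
  proof (rule infsum_mono[OF sums(2) summable_on_cmult_left[OF F]])
    fix l :: "int \<times> int"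
    show "t l \<le> cmod (F l) * (1 / (\<beta> * (real n)\<^sup>2))"
    proof (cases "fst l = 0 \<and> int n < \<bar>snd l\<bar>")
      case True
      then have "real n \<le> \<bar>real_of_int (snd l)\<bar>" by linarith
      then have "(real n)\<^sup>2 \<le> (of_int (snd l))\<^sup>2"
        by (simp add: power2_le_iff_abs_le abs_le_square_iff[symmetric])
      then have "\<beta> * (real n)\<^sup>2 * cmod (c l) \<le> \<beta> * (of_int (snd l))\<^sup>2 * cmod (c l)"
        using pos by (intro mult_right_mono mult_left_mono) auto
      also have "\<dots> \<le> cmod (F l)"
        using low True by simp
      finally show ?thesis
        using True pos by (simp add: t_def field_simps)
    qed (use pos in \<open>auto simp: t_def\<close>)
  qed
  then have T: "infsum t UNIV \<le> ?S / (\<beta> * (real n)\<^sup>2)"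
    by (subst (asm) infsum_cmult_left') simp
  let ?L = "{0::int} \<times> {- int n..int n}"
  have "(\<Sum>\<^sub>\<infinity>l. cmod (c l)) = (\<Sum>\<^sub>\<infinity>l. (p l + t l) + r l)"
    by (rule infsum_cong) (auto simp: p_def t_def r_def)
  also have "\<dots> = infsum p UNIV + infsum t UNIV + infsum r UNIV"
    using sums by (simp add: infsum_add summable_on_add)
  also have "infsum r UNIV = infsum r ?L"
    by (rule infsum_cong_neutral) (auto simp: r_def)
  also have "\<dots> = sum r ?L"
    by simp
  finally have split: "(\<Sum>\<^sub>\<infinity>l. cmod (c l)) = infsum p UNIV + infsum t UNIV + sum r ?L" .
  define B where "B = Max (cmod ` c ` ?L)"
  have "B \<in> cmod ` c ` ?L"
    unfolding B_def by (rule Max_in) auto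
  then obtain l where l: "l \<in> ?L" "B = cmod (c l)"
    by blast
  have "sum r ?L \<le> (\<Sum>l\<in>?L. B)"
  proof (rule sum_mono)
    fix k assume k: "k \<in> ?L"
    then have "cmod (c k) \<le> B"
      unfolding B_def by (intro Max_ge) auto
    then show "r k \<le> B"
      using k by (auto simp: r_def)
  qed
  also have "\<dots> = (2 * real n + 1) * cmod (c l)"
    by (simp add: l card_cartesian_product nat_add_distrib)
  finally show "\<exists>l. fst l = 0 \<and> (\<Sum>\<^sub>\<infinity>l. cmod (c l)) - ?S / \<alpha> - ?S / (\<beta> * (real n)\<^sup>2)
      \<le> (2 * real n + 1) * cmod (c l)"
    using l(1) P T split by (intro exI[of _ l]) auto
qed

section \<open>Triviality of small solutions for a Borel factor\<close>

text \<open>The constants are chosen in the order \<open>n\<close>, \<open>\<kappa>\<close>,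
  \<open>\<epsilon>1\<close>, from \<open>b\<close>, \<open>D\<close>, \<open>\<gamma>\<close> and
  \<open>K\<close> alone, hence uniformly in \<open>\<omega>1\<close> and \<open>u\<close>. The
  value \<open>\<epsilon> = 0\<close> is excluded because the bound for the axis modes is void
  there.\<close>

lemma small_solution_trivial:
  fixes b :: "real \<Rightarrow> real" and D :: nat and K \<gamma> \<epsilon>0 :: real
  assumes b: "b \<in> borel_measurable borel" "integrable circle b" "integral\<^sup>L circle b \<noteq> 0"
    and bs: "(\<lambda>l. cmod (fourier_coeff2 (\<lambda>\<phi>. of_real (b (fst \<phi>))) l)) summable_on UNIV"
    and D: "even D" "D > 0" and \<gamma>: "0 < \<gamma>" "\<gamma> \<le> 3" and K: "K \<ge> 0"
  shows "\<exists>\<epsilon>1>0. \<forall>\<epsilon> \<omega>1 u. (\<epsilon>, \<omega>1) \<in> diophantine_set \<epsilon>0 \<gamma> \<longrightarrow> \<epsilon> \<noteq> 0 \<longrightarrow> \<bar>\<epsilon>\<bar> < \<epsilon>1 \<longrightarrow>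
           (\<lambda>l. cmod (coeff u l)) summable_on UNIV \<longrightarrow>
           (\<forall>\<phi>. ((\<lambda>l. coeff u l * character l \<phi>) has_sum of_real (u \<phi>)) UNIV) \<longrightarrow>
           weak_solution (\<lambda>x y. b x * y ^ D) \<omega>1 (1 + \<epsilon>) u \<longrightarrow>
           (\<Sum>\<^sub>\<infinity>l. cmod (coeff u l)) ^ (D - 1) \<le> K * \<bar>\<epsilon>\<bar> \<longrightarrow>
           (\<Sum>\<^sub>\<infinity>l. cmod (coeff u l)) = 0"
proof -
  let ?b = "\<lambda>\<phi> :: real \<times> real. complex_of_real (b (fst \<phi>))"
  note [measurable] = b(1)
  have "integrable circle (\<lambda>_. 1 :: real)"
    using finite_measure_circle by (simp add: finite_measure.integrable_const)
  from integrable_torus_product[OF b(2) this] have bi: "integrable torus ?b"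
    by simp
  have bm: "?b \<in> borel_measurable borel"
    by (rule measurable_compose[OF measurable_compose[OF measurable_fst_borel b(1)] borel_measurable_of_real])
  define M where "M = (\<Sum>\<^sub>\<infinity>l. cmod (fourier_coeff2 ?b l)) * K"
  define A where "A = \<bar>integral\<^sup>L circle b\<bar>"
  define A1 where "A1 = (\<integral>x. \<bar>b x\<bar> \<partial>circle)"
  \<comment> \<open>\<open>\<delta> * \<bar>\<epsilon>\<bar> * U\<close> will bound the modes off
    the axis: the coefficients of \<open>b * u ^ D\<close> have norm at most
    \<open>M * \<bar>\<epsilon>\<bar> * U\<close>, and the symbol is at least
    \<open>\<gamma> / 3\<close>.\<close>
  define \<delta> where "\<delta> = 3 * M / \<gamma>"
  have M: "M \<ge> 0" and A: "A > 0" and A1: "A1 \<ge> 0"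
    using K b(3) by (simp_all add: M_def A_def A1_def infsum_nonneg)
  have \<delta>: "\<delta> \<ge> 0" using M \<gamma> by (simp add: \<delta>_def)
  \<comment> \<open>The tail on the axis will be at most \<open>M / n\<^sup>2 * U\<close>; this
    \<open>n\<close> makes it at most \<open>U / 4\<close>, independently of \<epsilon>.\<close>
  obtain n :: nat where "4 * M + 1 \<le> real n"
    using real_arch_simple by blast
  then have n: "n > 0" "4 * M \<le> real n"
    using M by (auto intro: Nat.gr0I)
  have "real n \<le> (real n)\<^sup>2"
    using n by (simp add: power2_eq_square)
  with n(2) have "4 * M \<le> (real n)\<^sup>2"
    by linarith
  then have Mn: "M / (real n)\<^sup>2 \<le> 1 / 4"
    using n by (simp add: divide_le_eq)
  \<comment> \<open>At least \<open>U / 2\<close> is left for \<open>2 * n + 1\<close> modes, so one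
    of them is at least \<open>2 * \<kappa> * U\<close>; half of this may be lost to
    \<open>P\<close>.\<close>
  define \<kappa> where "\<kappa> = 1 / (4 * (2 * real n + 1))"
  have \<kappa>: "\<kappa> > 0" "\<kappa> \<le> 1 / 4" "(2 * real n + 1) * \<kappa> = 1 / 4"
    by (simp_all add: \<kappa>_def divide_simps)
  \<comment> \<open>The three bounds serve the symbol estimates, \<open>P \<le> \<kappa> * U\<close>
    and the final contradiction. Adding 1 keeps the denominators positive when
    \<open>\<delta> = 0\<close>.\<close>
  define \<epsilon>1 where "\<epsilon>1 = Min {1 / 2, \<kappa> / (\<delta> + 1), A * \<kappa> ^ D / (A1 * real D * \<delta> + 1)}"
  have pos: "\<delta> + 1 > 0" "A1 * real D * \<delta> + 1 > 0"
    using \<delta> A1 by (auto intro: add_nonneg_pos)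
  have "\<epsilon>1 > 0"
    using pos \<kappa> A by (simp add: \<epsilon>1_def)
  moreover have "(\<Sum>\<^sub>\<infinity>l. cmod (coeff u l)) = 0"
    if dio: "(\<epsilon>, \<omega>1) \<in> diophantine_set \<epsilon>0 \<gamma>" and "\<epsilon> \<noteq> 0" and less: "\<bar>\<epsilon>\<bar> < \<epsilon>1"
      and c: "(\<lambda>l. cmod (coeff u l)) summable_on UNIV"
      and u: "\<forall>\<phi>. ((\<lambda>l. coeff u l * character l \<phi>) has_sum of_real (u \<phi>)) UNIV"
      and sol: "weak_solution (\<lambda>x y. b x * y ^ D) \<omega>1 (1 + \<epsilon>) u"
      and small: "(\<Sum>\<^sub>\<infinity>l. cmod (coeff u l)) ^ (D - 1) \<le> K * \<bar>\<epsilon>\<bar>"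
    for \<epsilon> \<omega>1 u
  proof (rule ccontr)
    assume ne: "(\<Sum>\<^sub>\<infinity>l. cmod (coeff u l)) \<noteq> 0"
    define U where "U = (\<Sum>\<^sub>\<infinity>l. cmod (coeff u l))"
    define P where "P = (\<Sum>\<^sub>\<infinity>l. if fst l = 0 then 0 else cmod (coeff u l))"
    define F where "F = fourier_coeff2 (\<lambda>\<phi>. ?b \<phi> * complex_of_real (u \<phi>) ^ D)"
    define S where "S = (\<Sum>\<^sub>\<infinity>l. cmod (F l))"
    have U: "U > 0"
      using ne infsum_nonneg[of UNIV "\<lambda>l. cmod (coeff u l)"] by (simp add: U_def less_le)
    have e: "\<bar>\<epsilon>\<bar> \<le> 1 / 2" "\<bar>\<epsilon>\<bar> < \<kappa> / (\<delta> + 1)" "\<bar>\<epsilon>\<bar> < A * \<kappa> ^ D / (A1 * real D * \<delta> + 1)"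
      using less by (simp_all add: \<epsilon>1_def)
    have "\<bar>\<epsilon>\<bar> * (\<delta> + 1) < \<kappa>" "\<bar>\<epsilon>\<bar> * (A1 * real D * \<delta> + 1) < A * \<kappa> ^ D"
      using e(2,3) pos by (simp_all add: pos_less_divide_eq)
    then have e\<kappa>: "\<delta> * \<bar>\<epsilon>\<bar> \<le> \<kappa>" and eA: "A1 * real D * \<delta> * \<bar>\<epsilon>\<bar> < A * \<kappa> ^ D"
      by (simp_all add: algebra_simps)
    have D': "U ^ D = U ^ (D - 1) * U"
      using power_minus_mult[OF D(2), of U] by simp
    have eq: "wave_symbol \<omega>1 (1 + \<epsilon>) l * coeff u l = - F l" for l
      using sol by (simp add: weak_solution_def F_def eq_neg_iff_add_eq_0 del: split_paired_All)
    have eq': "cmod (wave_symbol \<omega>1 (1 + \<epsilon>) l) * cmod (coeff u l) = cmod (F l)" for l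
      using arg_cong[OF eq[of l], of cmod] by (simp add: norm_mult)
    have F: "(\<lambda>l. cmod (F l)) summable_on UNIV"
      unfolding F_def using u by (intro summable_coeff_mult_series_power[OF c _ bm bi bs]) auto
    have "S \<le> (\<Sum>\<^sub>\<infinity>l. cmod (fourier_coeff2 ?b l)) * U ^ D"
      unfolding S_def F_def U_def using u by (intro infsum_coeff_mult_series_power[OF c _ bm bi bs]) auto
    \<comment> \<open>The ball condition trades \<open>U ^ (D - 1)\<close> for
      \<open>K * \<bar>\<epsilon>\<bar>\<close>; one factor \<open>U\<close> remains.\<close>
    also have "\<dots> \<le> (\<Sum>\<^sub>\<infinity>l. cmod (fourier_coeff2 ?b l)) * (K * \<bar>\<epsilon>\<bar> * U)"
      using small U unfolding D' by (intro mult_left_mono mult_right_mono infsum_nonneg) (auto simp: U_def)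
    finally have S: "S \<le> M * \<bar>\<epsilon>\<bar> * U"
      by (simp add: M_def ac_simps)
    have high: "\<gamma> / 3 * cmod (coeff u l) \<le> cmod (F l)" if "fst l \<noteq> 0" for l
      unfolding eq'[symmetric] by (intro mult_right_mono wave_symbol_ge[OF dio \<gamma> e(1) that]) simp
    have low: "\<bar>\<epsilon>\<bar> * (of_int (snd l))\<^sup>2 * cmod (coeff u l) \<le> cmod (F l)" if "fst l = 0" for l
      unfolding eq'[symmetric] by (intro mult_right_mono wave_symbol_fst_0_ge[OF e(1) that]) simp
    have \<gamma>3: "\<gamma> / 3 > 0" and \<epsilon>pos: "\<bar>\<epsilon>\<bar> > 0"
      using \<gamma> \<open>\<epsilon> \<noteq> 0\<close> by auto
    have S\<gamma>: "S / (\<gamma> / 3) \<le> \<delta> * \<bar>\<epsilon>\<bar> * U"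
      using S \<gamma> by (simp add: \<delta>_def field_simps)
    have PS: "P \<le> S / (\<gamma> / 3)"
      unfolding P_def S_def by (rule high_modes_le[OF c F high low \<gamma>3 \<epsilon>pos n(1)])
    obtain l where l: "fst l = 0"
      "U - S / (\<gamma> / 3) - S / (\<bar>\<epsilon>\<bar> * (real n)\<^sup>2) \<le> (2 * real n + 1) * cmod (coeff u l)"
      using exists_large_low_mode[OF c F high low \<gamma>3 \<epsilon>pos n(1)] unfolding U_def S_def by blast
    have \<kappa>U: "\<delta> * \<bar>\<epsilon>\<bar> * U \<le> \<kappa> * U"
      using e\<kappa> U by (intro mult_right_mono) auto
    also have "\<dots> \<le> 1 / 4 * U"
      using \<kappa> U by (intro mult_right_mono) auto
    finally have 1: "S / (\<gamma> / 3) \<le> U / 4"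
      using S\<gamma> by simp
    \<comment> \<open>The factor \<open>\<bar>\<epsilon>\<bar>\<close> gained from the ball
      condition cancels the small divisor of the axis modes.\<close>
    have "S / (\<bar>\<epsilon>\<bar> * (real n)\<^sup>2) \<le> M * \<bar>\<epsilon>\<bar> * U / (\<bar>\<epsilon>\<bar> * (real n)\<^sup>2)"
      using S by (intro divide_right_mono) auto
    also have "\<dots> = M / (real n)\<^sup>2 * U"
      using \<epsilon>pos by simp
    also have "\<dots> \<le> 1 / 4 * U"
      using Mn U by (intro mult_right_mono) auto
    finally have 2: "S / (\<bar>\<epsilon>\<bar> * (real n)\<^sup>2) \<le> U / 4"
      by simp
    have "(2 * real n + 1) * (2 * (\<kappa> * U)) = (2 * real n + 1) * \<kappa> * (2 * U)"
      by (simp only: mult_ac)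
    also have "\<dots> = U / 2"
      unfolding \<kappa>(3) by simp
    also have "\<dots> \<le> (2 * real n + 1) * cmod (coeff u l)"
      using l(2) 1 2 by linarith
    finally have "(2 * real n + 1) * (2 * (\<kappa> * U)) \<le> (2 * real n + 1) * cmod (coeff u l)" .
    then have "2 * (\<kappa> * U) \<le> cmod (coeff u l)"
      by (subst (asm) mult_le_cancel_left_pos) auto
    moreover have P\<kappa>: "P \<le> \<kappa> * U"
      using PS S\<gamma> \<kappa>U by linarith
    moreover have "0 \<le> \<kappa> * U"
      using \<kappa> U by simp
    ultimately have m: "\<kappa> * U \<le> cmod (coeff u l) - P" "P \<le> cmod (coeff u l)"
      by linarith+
    have "integral\<^sup>L torus (\<lambda>\<phi>. b (fst \<phi>) * u \<phi> ^ D) = 0"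
    proof -
      \<comment> \<open>The symbol vanishes at the origin, so the equation there is the solvability
        condition that \<open>b * u ^ D\<close> has mean zero.\<close>
      have "F 0 = 0"
        using eq[of 0] by (simp add: wave_symbol_def)
      moreover have "(\<lambda>\<phi>. complex_of_real (u \<phi>)) \<in> borel_measurable borel"
        using u by (intro fourier_series_measurable[OF c]) auto
      then have "(\<lambda>\<phi>. ?b \<phi> * complex_of_real (u \<phi>) ^ D) \<in> borel_measurable borel"
        using bm by measurable
      ultimately have "(\<integral>\<phi>. complex_of_real (b (fst \<phi>) * u \<phi> ^ D) \<partial>torus) = 0"
        unfolding F_def by (simp add: fourier_coeff2_borel)
      then show ?thesis
        by (simp only: integral_complex_of_real of_real_eq_0_iff)
    qed
    \<comment> \<open>Both sides are of order \<open>U ^ D\<close>, but the right one carries an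
      additional factor \<open>\<bar>\<epsilon>\<bar>\<close>; the third bound in
      \<open>\<epsilon>1\<close> then gives the contradiction.\<close>
    then have "A * (cmod (coeff u l) - P) ^ D \<le> A1 * (real D * U ^ (D - 1) * P)"
      unfolding A_def A1_def U_def P_def
      using u m(2) by (intro integral_power_lower_bound[OF b(1,2) c _ _ D]) (auto simp: P_def)
    also have "\<dots> \<le> A1 * (real D * U ^ (D - 1) * (\<delta> * \<bar>\<epsilon>\<bar> * U))"
      using PS S\<gamma> A1 U by (intro mult_left_mono) auto
    also have "\<dots> = A1 * real D * \<delta> * \<bar>\<epsilon>\<bar> * U ^ D"
      unfolding D' by (simp add: ac_simps)
    also have "\<dots> < A * \<kappa> ^ D * U ^ D"
      using eA U by (intro mult_strict_right_mono) auto
    also have "\<dots> = A * (\<kappa> * U) ^ D"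
      by (simp add: power_mult_distrib)
    also have "\<dots> \<le> A * (cmod (coeff u l) - P) ^ D"
      using m(1) \<kappa> U A by (intro mult_left_mono power_mono) auto
    finally show False by simp
  qed
  ultimately show ?thesis by blast
qed

section \<open>Comparison of the weighted and unweighted norms\<close>

lemma weight_ge_1: "\<sigma> \<ge> 0 \<Longrightarrow> s \<ge> 0 \<Longrightarrow> 1 \<le> weight \<sigma> s l"
  unfolding weight_def
  by (intro mult_ge1_I ge_one_powr_ge_zero) auto

text \<open>All weights are at least 1 for nonnegative exponents. Hence a threshold found for the
  unweighted norm is uniform in them.\<close>

lemma
  assumes u: "u \<in> H_space \<sigma> s" and "\<sigma> \<ge> 0" "s \<ge> 0"
  shows H_space_abs_summable: "(\<lambda>l. cmod (coeff u l)) summable_on UNIV"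
    and wiener_le_H_norm: "(\<Sum>\<^sub>\<infinity>l. cmod (coeff u l)) \<le> H_norm \<sigma> s u"
proof -
  have w: "(\<lambda>l. cmod (coeff u l) * weight \<sigma> s l) summable_on UNIV"
    using u by (simp add: H_space_def)
  have le: "cmod (coeff u l) \<le> cmod (coeff u l) * weight \<sigma> s l" for l
    using mult_left_mono[OF weight_ge_1[OF assms(2,3), of l] norm_ge_zero[of "coeff u l"]] by simp
  show s: "(\<lambda>l. cmod (coeff u l)) summable_on UNIV"
    by (rule summable_on_comparison_test[OF w le]) simp
  show "(\<Sum>\<^sub>\<infinity>l. cmod (coeff u l)) \<le> H_norm \<sigma> s u"
    unfolding H_norm_def by (rule infsum_mono[OF s w le])
qed

section \<open>Conclusion for a Sobolev factor\<close>

theorem proposition3: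
  fixes a :: "real \<Rightarrow> real" and D :: nat and s \<gamma> \<epsilon>0 :: real
  assumes "D \<ge> 2" and "even D"
    and "s \<ge> 1" and "a \<in> sobolev_torus s"
    and "(LINT x:{0..2 * pi}|lebesgue. a x) \<noteq> 0"
    and "0 < \<gamma>" and "\<gamma> < 1 / 6"
    and "\<epsilon>0 > 0"
  shows "\<forall>R>0. \<exists>\<epsilon>1>0. \<forall>\<sigma>\<ge>0. \<forall>sbar>s - 1 / 2. \<forall>(\<epsilon>, \<omega>1)\<in>diophantine_set \<epsilon>0 \<gamma>.
           \<bar>\<epsilon>\<bar> < \<epsilon>1 \<longrightarrow>
           \<not> (\<exists>u\<in>H_space \<sigma> sbar.
                 u \<noteq> (\<lambda>\<phi>. 0) \<and>
                 H_norm \<sigma> sbar u \<le> R * \<bar>\<epsilon>\<bar> powr (1 / (real D - 1)) \<and>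
                 weak_solution (\<lambda>x y. a x * y ^ D) \<omega>1 (1 + \<epsilon>) u)"
proof (intro allI impI)
  fix R :: real
  assume R: "R > 0"
  have am: "a \<in> borel_measurable lebesgue"
    and as: "(\<lambda>k::int. (1 + (of_int k)\<^sup>2) powr s * (cmod (fourier_coeff (\<lambda>x. of_real (a x)) k))\<^sup>2)
      summable_on UNIV"
    using assms(4) by (auto simp: sobolev_torus_def)
  \<comment> \<open>\<open>a\<close> is only Lebesgue measurable; a Borel function equal to it
    almost everywhere has the same Fourier coefficients and gives the same weak equation.\<close>
  obtain b where b: "b \<in> borel_measurable borel" and ab: "AE x in lborel. a x = b x"
    using completion_ex_borel_measurable_real[OF am] by auto
  have b0: "integral\<^sup>L circle b \<noteq> 0"
    using assms(5) set_integral_lebesgue_restrict_AE[OF _ b ab, of "{0..2 * pi}"] by (simp add: circle_def)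
  \<comment> \<open>The integral of a non-integrable function is 0 by convention, so a nonzero
    integral already gives integrability.\<close>
  then have bi: "integrable circle b"
    using not_integrable_integral_eq by blast
  have cb: "(\<lambda>x. complex_of_real (b x)) \<in> borel_measurable borel" "integrable circle (\<lambda>x. complex_of_real (b x))"
    using b bi by simp_all
  have "fourier_coeff (\<lambda>x. of_real (a x)) k = fourier_coeff (\<lambda>x. of_real (b x)) k" for k
    using ab by (simp add: fourier_coeff_AE[OF cb(1)] eventually_mono)
  then have bs: "(\<lambda>l. cmod (fourier_coeff2 (\<lambda>\<phi>. of_real (b (fst \<phi>))) l)) summable_on UNIV"
    using as by (intro coeff_fst_abs_summable[OF cb] sobolev_coeff_summable[OF assms(3)]) simp
  have "D > 0" "\<gamma> \<le> 3" "R ^ (D - 1) \<ge> 0"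
    using assms R by simp_all
  \<comment> \<open>Here \<open>K\<close> is \<open>R ^ (D - 1)\<close>, which comes from raising
    the ball condition to the power \<open>D - 1\<close>.\<close>
  note small_solution_trivial[OF b bi b0 bs assms(2) this(1) assms(6) this(2,3), of \<epsilon>0]
  then obtain \<epsilon>1 where \<epsilon>1: "\<epsilon>1 > 0" and triv: "\<And>\<epsilon> \<omega>1 u. (\<epsilon>, \<omega>1) \<in> diophantine_set \<epsilon>0 \<gamma> \<Longrightarrow> \<epsilon> \<noteq> 0 \<Longrightarrow> \<bar>\<epsilon>\<bar> < \<epsilon>1 \<Longrightarrow>
           (\<lambda>l. cmod (coeff u l)) summable_on UNIV \<Longrightarrow>
           (\<And>\<phi>. ((\<lambda>l. coeff u l * character l \<phi>) has_sum of_real (u \<phi>)) UNIV) \<Longrightarrow>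
           weak_solution (\<lambda>x y. b x * y ^ D) \<omega>1 (1 + \<epsilon>) u \<Longrightarrow>
           (\<Sum>\<^sub>\<infinity>l. cmod (coeff u l)) ^ (D - 1) \<le> R ^ (D - 1) * \<bar>\<epsilon>\<bar> \<Longrightarrow>
           (\<Sum>\<^sub>\<infinity>l. cmod (coeff u l)) = 0"
    by blast
  have trivial: "u = (\<lambda>\<phi>. 0)"
    if \<sigma>: "\<sigma> \<ge> 0" and sbar: "sbar > s - 1 / 2"
      and dio: "(\<epsilon>, \<omega>1) \<in> diophantine_set \<epsilon>0 \<gamma>" and less: "\<bar>\<epsilon>\<bar> < \<epsilon>1"
      and u: "u \<in> H_space \<sigma> sbar"
      and small: "H_norm \<sigma> sbar u \<le> R * \<bar>\<epsilon>\<bar> powr (1 / (real D - 1))"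
      and sol: "weak_solution (\<lambda>x y. a x * y ^ D) \<omega>1 (1 + \<epsilon>) u"
    for \<sigma> sbar \<epsilon> \<omega>1 u
  proof -
    define U where "U = (\<Sum>\<^sub>\<infinity>l. cmod (coeff u l))"
    have "sbar \<ge> 0" using sbar assms(3) by simp
    note c = H_space_abs_summable[OF u \<sigma> this] and le = wiener_le_H_norm[OF u \<sigma> this]
    have series: "((\<lambda>l. coeff u l * character l \<phi>) has_sum of_real (u \<phi>)) UNIV" for \<phi>
      using u unfolding H_space_def by blast
    have uc: "(\<lambda>\<phi>. complex_of_real (u \<phi>)) \<in> borel_measurable borel"
      by (rule fourier_series_measurable[OF c series])
    have U0: "U \<ge> 0" by (simp add: U_def infsum_nonneg)
    have UR: "U \<le> R * \<bar>\<epsilon>\<bar> powr (1 / (real D - 1))"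
      using le small by (simp add: U_def)
    have "U = 0"
    proof (cases "\<epsilon> = 0")
      case True
      \<comment> \<open>Since \<open>0 powr x = 0\<close>, the ball has radius 0 in this
        case.\<close>
      then show ?thesis using UR U0 by simp
    next
      case False
      have "U ^ (D - 1) \<le> (R * \<bar>\<epsilon>\<bar> powr (1 / (real D - 1))) ^ (D - 1)"
        by (rule power_mono[OF UR U0])
      also have "\<dots> = R ^ (D - 1) * \<bar>\<epsilon>\<bar> powr (1 / (real D - 1) * real (D - 1))"
        unfolding power_mult_distrib powr_powr[symmetric]
        by (subst powr_realpow) (use False in simp_all)
      also have "1 / (real D - 1) * real (D - 1) = 1"
        using assms(1) by (simp add: of_nat_diff)
      finally have "U ^ (D - 1) \<le> R ^ (D - 1) * \<bar>\<epsilon>\<bar>"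
        by simp
      moreover have "coeff (\<lambda>\<phi>. a (fst \<phi>) * u \<phi> ^ D) l = coeff (\<lambda>\<phi>. b (fst \<phi>) * u \<phi> ^ D) l" for l
      proof -
        have m: "(\<lambda>\<phi>. complex_of_real (b (fst \<phi>) * u \<phi> ^ D)) \<in> borel_measurable borel"
          using measurable_compose[OF measurable_fst_borel b] uc by simp
        have ae: "AE \<phi> in lborel. complex_of_real (a (fst \<phi>) * u \<phi> ^ D) = complex_of_real (b (fst \<phi>) * u \<phi> ^ D)"
          using AE_lborel_fst[OF ab] by eventually_elim simp
        show ?thesis
          unfolding fourier_coeff2_AE[OF m ae] by (rule fourier_coeff2_AE[OF m, symmetric]) simp
      qed
      then have "weak_solution (\<lambda>x y. b x * y ^ D) \<omega>1 (1 + \<epsilon>) u"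
        using sol by (simp add: weak_solution_def)
      ultimately show ?thesis
        unfolding U_def using triv[OF dio False less c series] by blast
    qed
    then have c0: "coeff u l = 0" for l
      using finite_sum_le_infsum[OF c, of "{l}"] by (simp add: U_def)
    show ?thesis
    proof
      fix \<phi>
      \<comment> \<open>Elements of the space are pointwise the sums of their series, so vanishing
        coefficients give \<open>u = 0\<close> everywhere and not only almost everywhere.\<close>
      have "((\<lambda>l. 0) has_sum complex_of_real (u \<phi>)) (UNIV :: (int \<times> int) set)"
        using series[of \<phi>] by (simp add: c0)
      then show "u \<phi> = 0"
        using has_sum_unique[OF has_sum_0] by fastforce
    qed
  qed
  show "\<exists>\<epsilon>1>0. \<forall>\<sigma>\<ge>0. \<forall>sbar>s - 1 / 2. \<forall>(\<epsilon>, \<omega>1)\<in>diophantine_set \<epsilon>0 \<gamma>.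
           \<bar>\<epsilon>\<bar> < \<epsilon>1 \<longrightarrow>
           \<not> (\<exists>u\<in>H_space \<sigma> sbar.
                 u \<noteq> (\<lambda>\<phi>. 0) \<and>
                 H_norm \<sigma> sbar u \<le> R * \<bar>\<epsilon>\<bar> powr (1 / (real D - 1)) \<and>
                 weak_solution (\<lambda>x y. a x * y ^ D) \<omega>1 (1 + \<epsilon>) u)"
    using \<epsilon>1 trivial by (intro exI[of _ \<epsilon>1]) blast
qed

end
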